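(* Fix $\eta=1$ (i.e. $\hat H=H$). The functional iteration scheme defined by $\hat F_0$ is unconditionally stable. For each $m=1,2,\ldots$, the functional iteration scheme defined by $\hat F_m$ is stable if and only if, for each $\ell=1,\ldots,N_f$, the pair $(H,\theta_\ell)$ lies in the stability region (the region where the right-hand side below is less than $1$) the boundary of which is given by the implicit equation $$1=2\sum_{j=1}^{m+1}\sum_{k=1}^{j-1}\binom{m+1}{j}\binom{m+1}{k}(-1)^{j+k}e^{-(j+k)H_\ell}\cos\left((j-k)H_\ell\tan\theta_\ell\right)+\sum_{k=1}^{m+1}\binom{m+1}{k}^2e^{-2kH_\ell},$$ where $H_\ell=-\lambda_{\ell,R}H/\varepsilon>0$ and $\theta_\ell\in(\pi/2,3\pi/2)$. In particular, if $\lambda_1,\ldots,\lambda_{N_f}$ are real, then the functional iteration is unconditionally stable. If at least one of the eigenvalues has a nonzero imaginary part, then a sufficient and uniform (in $\theta_1,\ldots,\theta_{N_f}$) condition for stability is that $$H>\frac{\varepsilon H_s(1)}{\min_\ell|\lambda_{\ell,R}|},\qquad\text{where } H_s(1)=-\ln\left(2^{1/(m+1)}-1\right)\ge0.$$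
   Context: Setting. Consider the fast--slow system $x'=f(x,y,\varepsilon)$, $\varepsilon y'=g(x,y,\varepsilon)$, with $x\in\mathbf{R}^{N_s}$, $y\in\mathbf{R}^{N_f}$, $'=d/dt$, $0<\varepsilon\ll1$, where $f,g$ are smooth. On $\{z=(x,y): g(z,0)=0\}$ one assumes $\det (D_yg)(z,0)\neq0$. The system has an $N_s$-dimensional, slow, invariant, normally attracting manifold $\mathcal{L}=\{(x,h(x)): x\in K\}$, $K\subset\mathbf{R}^{N_s}$, where $h$ satisfies $g(x,h(x),\varepsilon)-\varepsilon Dh(x)f(x,h(x),\varepsilon)=0$ and $h=\sum_{i\ge0}\varepsilon^ih_{[i]}$; in particular $g(x,h_{[0]}(x),0)=0$. Let $\phi(z;t)$ be the exact flow of the system with initial condition $z$, and $\phi^y$ its $y$-component. Let $H,\hat H>0$ be $\mathcal{O}(\varepsilon)$ quantities and $\eta=H/\hat H$, an $\mathcal{O}(1)$ parameter. Fix $x_0\in K$. The forward difference is $$(\Delta^{m+1}y)(z)=\sum_{\ell=0}^{m+1}(-1)^{m+1-\ell}\binom{m+1}{\ell}\phi^y(z;\ell\hat H),$$ and the map $\hat F_m:\mathbf{R}^{N_f}\to\mathbf{R}^{N_f}$ is $$\hat F_m(y)=y-(-\eta)^{m+1}(\Delta^{m+1}y)(x_0,y).$$ The functional iteration scheme defined by $\hat F_m$ is $y^{(r+1)}=\hat F_m(y^{(r)})$. The map $\hat F_m$ has an isolated fixed point $\hat h_m(x_0)$ that is $\mathcal{O}(\varepsilon^{m+1})$-close to $h(x_0)$.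 Spectrum. Let $\lambda_\ell=\lambda_{\ell,R}+i\lambda_{\ell,I}=|\lambda_\ell|e^{i\theta_\ell}=\lambda_{\ell,R}(1+i\tan\theta_\ell)$, $\ell=1,\ldots,N_f$, be the eigenvalues of $(D_yg)(x_0,h_{[0]}(x_0),0)$. Normal attractivity means $\lambda_{\ell,R}<0$, i.e. $\theta_\ell\in(\pi/2,3\pi/2)$, for all $\ell$. Stability. The scheme is called stable if the spectrum of the Jacobian $(D\hat F_m)(\hat h_m(x_0))$ is contained in the open unit disk of $\mathbf{C}$, understood to leading order in $\varepsilon$ (the Jacobian is replaced by its leading-order part as $\varepsilon\to0$ with $H/\varepsilon$ and $\hat H/\varepsilon$ fixed). Unconditionally stable means stable for all positive $\mathcal{O}(\varepsilon)$ values of $H$. *)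

theory Defs
  imports "HOL-Analysis.Analysis" "HOL-Library.Landau_Symbols"
begin

text \<open>Meant for open \<open>S\<close>. In finite dimensions, continuity of all iterated directional derivatives
  of a differentiable map is the usual notion of class \<open>C\<^sup>k\<close>.\<close>

primrec Ck_on :: "nat \<Rightarrow> 'a::euclidean_space set \<Rightarrow> ('a \<Rightarrow> 'b::euclidean_space) \<Rightarrow> bool" where
  "Ck_on 0 S F \<longleftrightarrow> continuous_on S F"
| "Ck_on (Suc k) S F \<longleftrightarrow>
     (\<forall>x\<in>S. F differentiable (at x)) \<and> (\<forall>v. Ck_on k S (\<lambda>x. frechet_derivative F (at x) v))"

definition smooth_on :: "'a::euclidean_space set \<Rightarrow> ('a \<Rightarrow> 'b::euclidean_space) \<Rightarrow> bool" where
  "smooth_on S F \<longleftrightarrow> (\<forall>k. Ck_on k S F)"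

abbreviation complexify :: "real^'n^'n \<Rightarrow> complex^'n^'n" where
  "complexify A \<equiv> map_matrix complex_of_real A"

definition spectrum :: "real^'n^'n \<Rightarrow> complex set" where
  "spectrum A = {\<mu>. \<exists>v. v \<noteq> 0 \<and> complexify A *v v = \<mu> *s v}"

text \<open>The family \<open>lam\<close>, indexed by the coordinate type, lists the eigenvalues of \<open>A\<close> with algebraic
  multiplicity.\<close>

definition eigenvalue_list :: "real^'n^'n \<Rightarrow> ('n \<Rightarrow> complex) \<Rightarrow> bool" where
  "eigenvalue_list A lam \<longleftrightarrow> (\<forall>z. det (mat z - complexify A) = (\<Prod>l\<in>UNIV. z - lam l))"

definition fast_jacobian ::
  "(real^'s \<Rightarrow> real^'f \<Rightarrow> real \<Rightarrow> real^'f) \<Rightarrow> real^'s \<Rightarrow> real^'f \<Rightarrow> real^'f^'f" where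
  "fast_jacobian g x y = jacobian (\<lambda>y. g x y 0) (at y)"

definition fast_slow_system ::
  "real \<Rightarrow> (real^'s \<Rightarrow> real^'f \<Rightarrow> real \<Rightarrow> real^'s) \<Rightarrow> (real^'s \<Rightarrow> real^'f \<Rightarrow> real \<Rightarrow> real^'f) \<Rightarrow> bool" where
  "fast_slow_system \<epsilon>0 f g \<longleftrightarrow>
     0 < \<epsilon>0 \<and>
     smooth_on (UNIV \<times> UNIV \<times> {-\<epsilon>0<..<\<epsilon>0}) (\<lambda>(x, y, \<epsilon>). f x y \<epsilon>) \<and>
     smooth_on (UNIV \<times> UNIV \<times> {-\<epsilon>0<..<\<epsilon>0}) (\<lambda>(x, y, \<epsilon>). g x y \<epsilon>) \<and>
     (\<forall>x y. g x y 0 = 0 \<longrightarrow> det (fast_jacobian g x y) \<noteq> 0)"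

text \<open>\<open>h \<epsilon>\<close> parametrizes the slow manifold over \<open>K\<close>, and \<open>hc i\<close> is the coefficient of \<open>\<epsilon>\<^sup>i\<close> in its
  expansion, which is understood in the asymptotic sense as \<open>\<epsilon>\<close> decreases to 0.\<close>

definition attracting_slow_manifold ::
  "real \<Rightarrow> (real^'s \<Rightarrow> real^'f \<Rightarrow> real \<Rightarrow> real^'s) \<Rightarrow> (real^'s \<Rightarrow> real^'f \<Rightarrow> real \<Rightarrow> real^'f) \<Rightarrow>
   (real^'s) set \<Rightarrow> (real \<Rightarrow> real^'s \<Rightarrow> real^'f) \<Rightarrow> (nat \<Rightarrow> real^'s \<Rightarrow> real^'f) \<Rightarrow> bool" where
  "attracting_slow_manifold \<epsilon>0 f g K h hc \<longleftrightarrow>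
     (\<forall>\<epsilon>\<in>{0<..<\<epsilon>0}. \<forall>x\<in>K. \<exists>D. (h \<epsilon> has_derivative D) (at x within K) \<and>
        g x (h \<epsilon> x) \<epsilon> - \<epsilon> *\<^sub>R D (f x (h \<epsilon> x) \<epsilon>) = 0) \<and>
     (\<forall>x\<in>K. \<forall>n. (\<lambda>\<epsilon>. norm (h \<epsilon> x - (\<Sum>i\<le>n. \<epsilon> ^ i *\<^sub>R hc i x))) \<in> O[at_right 0](\<lambda>\<epsilon>. \<epsilon> ^ (n + 1))) \<and>
     (\<forall>x\<in>K. g x (hc 0 x) 0 = 0) \<and>
     (\<forall>x\<in>K. spectrum (fast_jacobian g x (hc 0 x)) \<subseteq> {\<mu>. Re \<mu> < 0})"

text \<open>No global existence is demanded: \<open>\<phi> z t\<close> is the value at time \<open>t\<close> of the solution starting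
  at \<open>z\<close> whenever there is a solution on \<open>[0,t]\<close> (it is unique for locally Lipschitz \<open>F\<close>), and
  arbitrary otherwise.\<close>

definition exact_flow ::
  "('a::real_normed_vector \<Rightarrow> 'a) \<Rightarrow> ('a \<Rightarrow> real \<Rightarrow> 'a) \<Rightarrow> bool" where
  "exact_flow F \<phi> \<longleftrightarrow>
     (\<forall>z t u. 0 \<le> t \<and> u 0 = z \<and>
        (\<forall>s\<in>{0..t}. (u has_vector_derivative F (u s)) (at s within {0..t})) \<longrightarrow> \<phi> z t = u t)"

definition fast_slow_field ::
  "(real^'s \<Rightarrow> real^'f \<Rightarrow> real \<Rightarrow> real^'s) \<Rightarrow> (real^'s \<Rightarrow> real^'f \<Rightarrow> real \<Rightarrow> real^'f) \<Rightarrow>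
   real \<Rightarrow> (real^'s) \<times> (real^'f) \<Rightarrow> (real^'s) \<times> (real^'f)" where
  "fast_slow_field f g \<epsilon> = (\<lambda>(x, y). (f x y \<epsilon>, (1 / \<epsilon>) *\<^sub>R g x y \<epsilon>))"

definition forward_difference_y ::
  "((real^'s) \<times> (real^'f) \<Rightarrow> real \<Rightarrow> (real^'s) \<times> (real^'f)) \<Rightarrow> real \<Rightarrow> nat \<Rightarrow> (real^'s) \<times> (real^'f) \<Rightarrow> real^'f" where
  "forward_difference_y \<phi> Hh n z =
     (\<Sum>l=0..n. ((-1) ^ (n - l) * real (n choose l)) *\<^sub>R snd (\<phi> z (real l * Hh)))"

definition Fhat ::
  "((real^'s) \<times> (real^'f) \<Rightarrow> real \<Rightarrow> (real^'s) \<times> (real^'f)) \<Rightarrow> real^'s \<Rightarrow> real \<Rightarrow> real \<Rightarrow> nat \<Rightarrow>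
   real^'f \<Rightarrow> real^'f" where
  "Fhat \<phi> x0 H Hh m y =
     y - ((- (H / Hh)) ^ (m + 1)) *\<^sub>R forward_difference_y \<phi> Hh (m + 1) (x0, y)"

definition isolated_fixed_point :: "('a::metric_space \<Rightarrow> 'a) \<Rightarrow> 'a \<Rightarrow> bool" where
  "isolated_fixed_point F p \<longleftrightarrow> F p = p \<and> (\<exists>d>0. \<forall>y\<in>ball p d. F y = y \<longrightarrow> y = p)"

text \<open>Below, \<open>\<Phi> \<epsilon>\<close> is the flow for the parameter \<open>\<epsilon>\<close>, and \<open>yhat m \<epsilon> H Hh\<close> is the distinguished
  fixed point of \<open>Fhat (\<Phi> \<epsilon>) x0 H Hh m\<close>. The order-\<open>\<epsilon>\<close> quantities \<open>H\<close>, \<open>Hh\<close> are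
  written \<open>\<sigma> * \<epsilon>\<close>, \<open>\<sigma>h * \<epsilon>\<close>, with the ratios fixed as \<open>\<epsilon>\<close> decreases to 0.\<close>

definition fixed_point_branch ::
  "(real \<Rightarrow> (real^'s) \<times> (real^'f) \<Rightarrow> real \<Rightarrow> (real^'s) \<times> (real^'f)) \<Rightarrow> real^'s \<Rightarrow>
   (real \<Rightarrow> real^'s \<Rightarrow> real^'f) \<Rightarrow> (nat \<Rightarrow> real \<Rightarrow> real \<Rightarrow> real \<Rightarrow> real^'f) \<Rightarrow>
   nat \<Rightarrow> real \<Rightarrow> real \<Rightarrow> bool" where
  "fixed_point_branch \<Phi> x0 h yhat m \<sigma> \<sigma>h \<longleftrightarrow>
     (\<forall>\<^sub>F \<epsilon> in at_right 0.
        isolated_fixed_point (Fhat (\<Phi> \<epsilon>) x0 (\<sigma> * \<epsilon>) (\<sigma>h * \<epsilon>) m) (yhat m \<epsilon> (\<sigma> * \<epsilon>) (\<sigma>h * \<epsilon>))) \<and>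
     (\<lambda>\<epsilon>. norm (yhat m \<epsilon> (\<sigma> * \<epsilon>) (\<sigma>h * \<epsilon>) - h \<epsilon> x0)) \<in> O[at_right 0](\<lambda>\<epsilon>. \<epsilon> ^ (m + 1))"

definition leading_order_jacobian ::
  "(real \<Rightarrow> (real^'s) \<times> (real^'f) \<Rightarrow> real \<Rightarrow> (real^'s) \<times> (real^'f)) \<Rightarrow> real^'s \<Rightarrow>
   (nat \<Rightarrow> real \<Rightarrow> real \<Rightarrow> real \<Rightarrow> real^'f) \<Rightarrow> nat \<Rightarrow> real \<Rightarrow> real \<Rightarrow> real^'f^'f \<Rightarrow> bool" where
  "leading_order_jacobian \<Phi> x0 yhat m \<sigma> \<sigma>h A \<longleftrightarrow>
     (\<forall>\<^sub>F \<epsilon> in at_right 0.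
        Fhat (\<Phi> \<epsilon>) x0 (\<sigma> * \<epsilon>) (\<sigma>h * \<epsilon>) m differentiable (at (yhat m \<epsilon> (\<sigma> * \<epsilon>) (\<sigma>h * \<epsilon>)))) \<and>
     ((\<lambda>\<epsilon>. jacobian (Fhat (\<Phi> \<epsilon>) x0 (\<sigma> * \<epsilon>) (\<sigma>h * \<epsilon>) m) (at (yhat m \<epsilon> (\<sigma> * \<epsilon>) (\<sigma>h * \<epsilon>))))
        \<longlongrightarrow> A) (at_right 0)"

text \<open>Stability is a leading-order notion, so it depends on \<open>\<epsilon>\<close>, \<open>H\<close>, \<open>Hh\<close> only through the
  ratios \<open>H / \<epsilon>\<close> and \<open>Hh / \<epsilon>\<close>; no smallness of \<open>\<epsilon>\<close> needs to be imposed.\<close>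

definition scheme_stable ::
  "(real \<Rightarrow> (real^'s) \<times> (real^'f) \<Rightarrow> real \<Rightarrow> (real^'s) \<times> (real^'f)) \<Rightarrow> real^'s \<Rightarrow>
   (nat \<Rightarrow> real \<Rightarrow> real \<Rightarrow> real \<Rightarrow> real^'f) \<Rightarrow> nat \<Rightarrow> real \<Rightarrow> real \<Rightarrow> real \<Rightarrow> bool" where
  "scheme_stable \<Phi> x0 yhat m \<epsilon> H Hh \<longleftrightarrow>
     (\<exists>A. leading_order_jacobian \<Phi> x0 yhat m (H / \<epsilon>) (Hh / \<epsilon>) A \<and> spectrum A \<subseteq> ball 0 1)"

definition unconditionally_stable ::
  "(real \<Rightarrow> (real^'s) \<times> (real^'f) \<Rightarrow> real \<Rightarrow> (real^'s) \<times> (real^'f)) \<Rightarrow> real^'s \<Rightarrow>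
   (nat \<Rightarrow> real \<Rightarrow> real \<Rightarrow> real \<Rightarrow> real^'f) \<Rightarrow> nat \<Rightarrow> real \<Rightarrow> bool" where
  "unconditionally_stable \<Phi> x0 yhat m \<eta> \<longleftrightarrow>
     (\<forall>\<epsilon> H. 0 < \<epsilon> \<and> 0 < H \<longrightarrow> scheme_stable \<Phi> x0 yhat m \<epsilon> H (H / \<eta>))"

text \<open>Here \<open>Hl\<close> stands for the scaled step \<open>H\<^sub>l = - Re \<lambda>\<^sub>l * H / \<epsilon>\<close>.\<close>

definition stability_rhs :: "nat \<Rightarrow> real \<Rightarrow> real \<Rightarrow> real" where
  "stability_rhs m Hl \<theta> =
     2 * (\<Sum>j=1..m+1. \<Sum>k=1..j-1. real ((m+1) choose j) * real ((m+1) choose k) * (-1) ^ (j + k) *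
            exp (- real (j + k) * Hl) * cos (real (j - k) * Hl * tan \<theta>))
     + (\<Sum>k=1..m+1. (real ((m+1) choose k))\<^sup>2 * exp (- 2 * real k * Hl))"

definition parameter_domain :: "(real \<times> real) set" where
  "parameter_domain = {0<..} \<times> {pi/2<..<3*pi/2}"

text \<open>The region in the \<open>(H, \<theta>)\<close>-plane belonging to an eigenvalue with real part \<open>lamR\<close>.\<close>

definition stability_region :: "nat \<Rightarrow> real \<Rightarrow> real \<Rightarrow> (real \<times> real) set" where
  "stability_region m \<epsilon> lamR =
     {(H, \<theta>) \<in> parameter_domain. stability_rhs m (- lamR * H / \<epsilon>) \<theta> < 1}"

definition H_s :: "nat \<Rightarrow> real" where
  "H_s m = - ln (2 powr (1 / real (m + 1)) - 1)"

end

theory Submission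
  imports Defs "HOL-Computational_Algebra.Fundamental_Theorem_Algebra"
begin

text \<open>In the fast time \<open>\<tau> = t / \<epsilon>\<close> the system reads \<open>x' = \<epsilon> f\<close>, \<open>y' = g\<close>. For \<open>\<epsilon> = 0\<close> the point
  \<open>(x0, hc 0 x0)\<close> is an equilibrium, and the fast component of the flow linearized there is
  \<open>exp (\<tau> B)\<close>, where \<open>B\<close> is the fast Jacobian. The fixed points of the iteration converge to this
  equilibrium, so with \<open>H = \<sigma> \<epsilon>\<close> the Jacobians of the iteration function at the fixed points
  converge to \<open>1 - (1 - exp (\<sigma> B)) ^ (m + 1)\<close>
  (\<open>leading_order_jacobian_exists\<close>). This needs the differentiability of the flow in the initial
  point and the continuity of its derivative as the initial point and \<open>\<epsilon>\<close> tend to their limits; both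
  are part of \<open>flow_near_equilibrium\<close>, applied to the system in which \<open>\<epsilon>\<close> is a further state variable.

  By the spectral mapping theorem \<open>spectrum_matrix_flow_combination\<close>, the eigenvalues of the limit
  are \<open>1 - (1 - exp (\<sigma> \<lambda>)) ^ (m + 1)\<close> for the eigenvalues \<open>\<lambda>\<close> of \<open>B\<close>. Stability means that they all
  have modulus less than 1, and the squared modulus is the trigonometric sum of the statement
  (\<open>stability_rhs_eq_amplification\<close>). The claims then concern one holomorphic function on the left
  half-plane, \<open>F \<zeta> = 1 - (1 - exp \<zeta>) ^ n\<close>. For \<open>n = 1\<close> it is \<open>exp \<zeta>\<close>. For real \<open>\<zeta> < 0\<close> its values
  lie strictly between 0 and 1. In general \<open>norm (F \<zeta>) \<le> (1 + exp (Re \<zeta>)) ^ n - 1\<close>, which is below 1 once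
  \<open>- Re \<zeta>\<close> exceeds \<open>H_s\<close>. Finally, \<open>F'\<close> has no zero in the left half-plane, so the modulus of \<open>F\<close> has no
  local minimum with value 1, and the level set of the value 1 is the frontier of the stability
  region.\<close>

section \<open>Differential equations and flows near an equilibrium\<close>

text \<open>Only the derivative of \<open>w\<close> is bounded, not that of \<open>norm w\<close>, which need not exist. Integrating
  the bound gives a differentiable majorant \<open>R\<close> of \<open>norm w\<close> with \<open>R' \<le> b + a R\<close>, and then
  \<open>b t - exp (- a t) R t\<close> is nondecreasing.\<close>

lemma gronwall:
  fixes w :: "real \<Rightarrow> 'a::banach"
  assumes deriv: "\<And>t. t \<in> {0..T} \<Longrightarrow> (w has_vector_derivative w' t) (at t within {0..T})"
    and bound: "\<And>t. t \<in> {0..T} \<Longrightarrow> norm (w' t) \<le> a * norm (w t) + b"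
    and nonneg: "0 \<le> a" "0 \<le> b" and t: "t \<in> {0..T}"
  shows "norm (w t) \<le> (norm (w 0) + b * t) * exp (a * t)"
proof -
  define R where "R t = norm (w 0) + b * t + a * integral {0..t} (\<lambda>s. norm (w s))" for t
  have cont: "continuous_on {0..T} w"
    by (meson deriv continuous_on_vector_derivative)
  hence contn: "continuous_on {0..T} (\<lambda>s. norm (w s))"
    by (intro continuous_intros)
  have wR: "norm (w t) \<le> R t" if t: "t \<in> {0..T}" for t
  proof -
    have sub: "{0..t} \<subseteq> {0..T}" using t by auto
    have int: "(w' has_integral w t - w 0) {0..t}"
      by (rule fundamental_theorem_of_calculus)
        (use t sub in \<open>auto intro: has_vector_derivative_within_subset[OF deriv sub]\<close>)
    have int2: "(\<lambda>s. a * norm (w s) + b) integrable_on {0..t}"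
      by (intro integrable_continuous_real continuous_intros continuous_on_subset[OF cont sub])
    have "norm (w t - w 0) = norm (integral {0..t} w')"
      using int by (simp add: integral_unique)
    also have "\<dots> \<le> integral {0..t} (\<lambda>s. a * norm (w s) + b)"
      by (rule integral_norm_bound_integral[OF _ int2]) (use int bound sub in auto)
    also have "\<dots> = a * integral {0..t} (\<lambda>s. norm (w s)) + b * t"
      using t by (subst integral_add)
        (auto intro!: integrable_continuous_real continuous_intros continuous_on_subset[OF cont sub])
    finally show ?thesis
      unfolding R_def using norm_triangle_sub[of "w t" "w 0"] by linarith
  qed
  have dR: "(R has_real_derivative (b + a * norm (w t))) (at t within {0..T})" if "t \<in> {0..T}" for t
    unfolding R_def
    by (rule derivative_eq_intros integral_has_real_derivative[OF contn that] refl)+ simp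
  have "exp (- a * t) * R t - exp (- a * 0) * R 0 \<le> b * t - b * 0"
  proof -
    define q where "q t = b * t - exp (- a * t) * R t" for t
    have dq: "(q has_real_derivative (b - (exp (- a * s) * (b + a * norm (w s)) - a * exp (- a * s) * R s)))
       (at s within {0..T})" if "s \<in> {0..T}" for s
      unfolding q_def by (rule derivative_eq_intros dR[OF that] refl)+ (simp add: algebra_simps)
    have "q 0 \<le> q t"
    proof (rule DERIV_nonneg_imp_increasing_open[of 0 t q])
      show "0 \<le> t" using t by simp
      show "continuous_on {0..t} q"
        by (rule continuous_on_subset[of "{0..T}"])
          (use t in \<open>auto intro!: DERIV_continuous_on[OF dq]\<close>)
      fix s assume s: "0 < s" "s < t"
      hence s': "s \<in> {0<..<T}" using t by auto
      have "(q has_real_derivative (b - (exp (- a * s) * (b + a * norm (w s)) - a * exp (- a * s) * R s))) (at s)"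
        using dq[of s] s' at_within_Icc_at[of 0 s T] by auto
      moreover have "exp (- a * s) * (b + a * norm (w s)) - a * exp (- a * s) * R s \<le> b"
      proof -
        have "a * norm (w s) \<le> a * R s" using wR[of s] s' nonneg by (auto intro: mult_left_mono)
        hence "exp (- a * s) * (b + a * norm (w s)) \<le> exp (- a * s) * (b + a * R s)" by simp
        moreover have "exp (- a * s) * b \<le> 1 * b"
          using nonneg s by (intro mult_right_mono) auto
        ultimately show ?thesis by (simp add: algebra_simps)
      qed
      ultimately show "\<exists>y. DERIV q s :> y \<and> 0 \<le> y" by (intro exI conjI) auto
    qed
    thus ?thesis by (simp add: q_def)
  qed
  hence "exp (- a * t) * R t \<le> norm (w 0) + b * t" by (simp add: R_def)
  hence "R t \<le> (norm (w 0) + b * t) * exp (a * t)"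
    by (simp add: exp_minus field_simps)
  thus ?thesis using wR[OF t] by linarith
qed

lemma linear_ode_zero:
  fixes w :: "real \<Rightarrow> 'a::banach"
  assumes "bounded_linear A" "w 0 = 0" "t \<in> {0..T}"
    and "\<And>t. t \<in> {0..T} \<Longrightarrow> (w has_vector_derivative A (w t)) (at t within {0..T})"
  shows "w t = 0"
proof -
  have "norm (w t) \<le> (norm (w 0) + 0 * t) * exp (onorm A * t)"
    by (rule gronwall[OF assms(4) _ _ _ assms(3)])
      (use onorm[OF assms(1)] onorm_pos_le[OF assms(1)] in auto)
  thus ?thesis using assms(2) by simp
qed

text \<open>A global Lipschitz condition gives a solution on the whole interval in one step: after
  substituting \<open>u t = exp (2 L t) v t\<close>, the Picard operator is a contraction with factor 1/2 for the
  supremum norm, whatever the length of the interval. The right-hand side is only asked to turn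
  continuous curves into continuous curves, which suits the nonautonomous linear equation satisfied
  by the derivative of a flow.\<close>

lemma picard_lindelof:
  fixes F :: "real \<Rightarrow> 'a::banach \<Rightarrow> 'a"
  assumes T: "0 \<le> T" and L: "0 < L"
    and cont: "\<And>x. continuous_on {0..T} x \<Longrightarrow> continuous_on {0..T} (\<lambda>t. F t (x t))"
    and lip: "\<And>t x y. t \<in> {0..T} \<Longrightarrow> norm (F t x - F t y) \<le> L * norm (x - y)"
  shows "\<exists>u. u 0 = z \<and> (\<forall>t\<in>{0..T}. (u has_vector_derivative F t (u t)) (at t within {0..T}))"
proof -
  define E where "E t = exp (2 * L * t)" for t
  define P where "P v t = inverse (E t) *\<^sub>R (z + integral {0..t} (\<lambda>s. F s (E s *\<^sub>R v s)))"
    for v :: "real \<Rightarrow>\<^sub>C 'a" and t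
  have contF: "continuous_on {0..T} (\<lambda>s. F s (E s *\<^sub>R v s))" for v :: "real \<Rightarrow>\<^sub>C 'a"
    unfolding E_def by (intro cont continuous_intros continuous_on_apply_bcontfun)
  have contP: "continuous_on {0..T} (P v)" for v
    unfolding P_def
    by (intro continuous_intros indefinite_integral_continuous_1 integrable_continuous_real contF)
      (auto simp: E_def intro!: continuous_intros)
  \<comment> \<open>\<open>Q\<close> is \<open>P\<close> as a self-map of a Banach space: curves on \<open>{0..T}\<close> are extended by constants.\<close>
  have "\<exists>w::real \<Rightarrow>\<^sub>C 'a. \<forall>t. w t = P v (clamp 0 T t)" for v
    using continuous_on_cbox_bcontfunE[of 0 T "P v"] contP[of v] by (simp add: cbox_interval) metis
  then obtain Q :: "(real \<Rightarrow>\<^sub>C 'a) \<Rightarrow> (real \<Rightarrow>\<^sub>C 'a)" where Q: "\<And>v t. Q v t = P v (clamp 0 T t)"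
    by metis
  have PP: "dist (P v t) (P w t) \<le> 1/2 * dist v w" if t: "t \<in> {0..T}" for v w t
  proof -
    have sub: "{0..t} \<subseteq> {0..T}" using t by auto
    have i: "(\<lambda>s. F s (E s *\<^sub>R v s)) integrable_on {0..t}" for v :: "real \<Rightarrow>\<^sub>C 'a"
      by (intro integrable_continuous_real continuous_on_subset[OF contF sub])
    have I: "((\<lambda>s. L * (E s * dist v w)) has_integral (E t - 1) / 2 * dist v w) {0..t}"
    proof -
      have "((\<lambda>s. L * (E s * dist v w)) has_integral E t / 2 * dist v w - E 0 / 2 * dist v w) {0..t}"
        by (rule fundamental_theorem_of_calculus)
          (use t in \<open>auto simp: E_def has_real_derivative_iff_has_vector_derivative[symmetric]
             intro!: derivative_eq_intros\<close>)
      thus ?thesis by (simp add: E_def algebra_simps diff_divide_distrib)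
    qed
    have "dist (P v t) (P w t) = inverse (E t) * norm (integral {0..t} (\<lambda>s. F s (E s *\<^sub>R v s) - F s (E s *\<^sub>R w s)))"
      unfolding P_def dist_norm scaleR_diff_right[symmetric]
      by (subst integral_diff[OF i i]) (simp add: E_def)
    also have "norm (integral {0..t} (\<lambda>s. F s (E s *\<^sub>R v s) - F s (E s *\<^sub>R w s))) \<le> integral {0..t} (\<lambda>s. L * (E s * dist v w))"
    proof (rule integral_norm_bound_integral)
      show "(\<lambda>s. F s (E s *\<^sub>R v s) - F s (E s *\<^sub>R w s)) integrable_on {0..t}"
        by (intro integrable_diff i)
      show "(\<lambda>s. L * (E s * dist v w)) integrable_on {0..t}" using I by blast
      fix s assume "s \<in> {0..t}"
      hence s: "s \<in> {0..T}" using sub by auto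
      have "norm (F s (E s *\<^sub>R v s) - F s (E s *\<^sub>R w s)) \<le> L * norm (E s *\<^sub>R v s - E s *\<^sub>R w s)"
        by (rule lip[OF s])
      also have "norm (E s *\<^sub>R v s - E s *\<^sub>R w s) = E s * dist (v s) (w s)"
        by (simp add: dist_norm scaleR_diff_right[symmetric] E_def)
      also have "L * (E s * dist (v s) (w s)) \<le> L * (E s * dist v w)"
        using L dist_bounded[of v s w] by (simp add: E_def)
      finally show "norm (F s (E s *\<^sub>R v s) - F s (E s *\<^sub>R w s)) \<le> L * (E s * dist v w)" .
    qed
    also have "\<dots> = (E t - 1) / 2 * dist v w" using I by (rule integral_unique)
    also have "inverse (E t) * ((E t - 1) / 2 * dist v w) \<le> 1/2 * dist v w"
    proof -
      have "E t > 0" by (simp add: E_def)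
      hence "inverse (E t) * ((E t - 1) / 2) \<le> 1/2" by (simp add: field_simps)
      from mult_right_mono[OF this, of "dist v w"] show ?thesis by (simp add: algebra_simps)
    qed
    finally show ?thesis by (simp add: E_def)
  qed
  have "dist (Q v) (Q w) \<le> 1/2 * dist v w" for v w
    by (rule dist_bound) (use T PP clamp_in_interval[of 0 T] in \<open>auto simp: Q cbox_interval\<close>)
  then obtain v where v: "Q v = v"
    using banach_fix_type[of "1/2" Q] by auto
  define u where "u t = z + integral {0..t} (\<lambda>s. F s (E s *\<^sub>R v s))" for t
  have uv: "u t = E t *\<^sub>R v t" if "t \<in> {0..T}" for t
    using Q[of v t] that by (simp add: v P_def u_def cbox_interval E_def)
  have "(u has_vector_derivative F t (u t)) (at t within {0..T})" if t: "t \<in> {0..T}" for t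
    unfolding uv[OF t] unfolding u_def
    by (rule derivative_eq_intros integral_has_vector_derivative[OF contF t] refl)+ simp
  moreover have "u 0 = z" by (simp add: u_def)
  ultimately show ?thesis by blast
qed

text \<open>Near an equilibrium the solution stays close to it for any prescribed time \<open>T\<close>, provided that it
  starts close enough, so a local Lipschitz constant governs everything. Existence comes from
  composing \<open>G\<close> with the projection \<open>c\<close> onto a closed ball, which makes the field globally
  Lipschitz without changing it on the ball. The derivative \<open>V\<close> of the flow is the solution of the
  variational equation; that it is the derivative, and that it depends continuously on the initial
  point at the equilibrium, are two applications of Gronwall's inequality, both resting on the uniform
  continuity of \<open>G'\<close> on the ball.\<close>

lemma flow_near_equilibrium:
  fixes G :: "'a::euclidean_space \<Rightarrow> 'a" and G' :: "'a \<Rightarrow> 'a \<Rightarrow>\<^sub>L 'a"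
  assumes S: "open S" "p0 \<in> S" and equilibrium: "G p0 = 0" and T: "0 \<le> T"
    and deriv: "\<And>p. p \<in> S \<Longrightarrow> (G has_derivative blinfun_apply (G' p)) (at p)"
    and cont: "continuous_on S G'"
  obtains \<delta> u V where "\<delta> > 0"
    and "\<And>p. u p 0 = p"
    and "\<And>p t. p \<in> ball p0 \<delta> \<Longrightarrow> t \<in> {0..T} \<Longrightarrow> u p t \<in> S"
    and "\<And>p t. p \<in> ball p0 \<delta> \<Longrightarrow> t \<in> {0..T} \<Longrightarrow>
      (u p has_vector_derivative G (u p t)) (at t within {0..T})"
    and "\<And>p t. p \<in> ball p0 \<delta> \<Longrightarrow> t \<in> {0..T} \<Longrightarrow>
      ((\<lambda>q. u q t) has_derivative blinfun_apply (V p t)) (at p)"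
    and "\<And>t. t \<in> {0..T} \<Longrightarrow> ((\<lambda>p. V p t) \<longlongrightarrow> V p0 t) (at p0)"
    and "V p0 0 = id_blinfun"
    and "\<And>t. t \<in> {0..T} \<Longrightarrow>
      (V p0 has_vector_derivative G' p0 o\<^sub>L V p0 t) (at t within {0..T})"
proof -
  obtain r where r: "r > 0" and rS: "cball p0 r \<subseteq> S"
    using S open_contains_cball by blast
  define B where "B = cball p0 r"
  have B: "convex B" "closed B" "B \<noteq> {}" "compact B" "p0 \<in> B" using r by (auto simp: B_def)
  have contB: "continuous_on B G'" using cont rS continuous_on_subset unfolding B_def by blast
  have derB: "(G has_derivative blinfun_apply (G' x)) (at x within X)" if "x \<in> B" for x X
    using deriv that rS unfolding B_def by (blast intro: has_derivative_at_withinI)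
  obtain L where L: "L > 0" "\<And>p. p \<in> B \<Longrightarrow> norm (G' p) \<le> L"
  proof -
    have "bounded (G' ` B)"
      by (intro compact_imp_bounded compact_continuous_image contB B)
    then obtain b where "b > 0" "\<forall>x\<in>G' ` B. norm x \<le> b" using bounded_pos by blast
    thus ?thesis using that by blast
  qed
  have lipB: "norm (G x - G y) \<le> L * norm (x - y)" if "x \<in> B" "y \<in> B" for x y
  proof (rule differentiable_bound[OF B(1) _ _ that])
    show "(G has_derivative blinfun_apply (G' x)) (at x within B)" if "x \<in> B" for x
      using that by (rule derB)
    show "onorm (blinfun_apply (G' x)) \<le> L" if "x \<in> B" for x
      using L(2)[OF that] by (simp add: norm_blinfun.rep_eq)
  qed
  define c where "c = closest_point B"
  have cB: "c p \<in> B" for p unfolding c_def using B by (intro closest_point_in_set) auto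
  have c_id: "p \<in> B \<Longrightarrow> c p = p" for p by (simp add: c_def closest_point_self)
  have c_lip: "norm (c p - c q) \<le> norm (p - q)" for p q
    using closest_point_lipschitz[OF B(1-3), of p q] by (simp add: c_def dist_norm)
  have c_cont: "continuous_on X c" for X
    unfolding c_def by (intro continuous_on_closest_point B)
  have G_lip: "norm (G (c p) - G (c q)) \<le> L * norm (p - q)" for p q
    using order_trans[OF lipB[OF cB cB, of p q] mult_left_mono[OF c_lip[of p q], of L]] L(1) by simp
  have G_cont: "continuous_on B G"
    by (rule has_derivative_continuous_on[of _ _ "\<lambda>p. blinfun_apply (G' p)"])
      (rule derB)
  have "\<exists>u. u 0 = p \<and> (\<forall>t\<in>{0..T}. (u has_vector_derivative G (c (u t))) (at t within {0..T}))" for p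
    by (rule picard_lindelof[OF T L(1)])
      (auto intro!: G_lip continuous_on_compose2[OF G_cont] continuous_on_compose2[OF c_cont] cB)
  then obtain u where u0: "\<And>p. u p 0 = p"
    and u: "\<And>p t. t \<in> {0..T} \<Longrightarrow> (u p has_vector_derivative G (c (u p t))) (at t within {0..T})"
    by metis
  have u_cont: "continuous_on {0..T} (u p)" for p
    by (meson u continuous_on_vector_derivative)
  have V_ex: "\<exists>V. V 0 = id_blinfun \<and>
    (\<forall>t\<in>{0..T}. (V has_vector_derivative G' (c (u p t)) o\<^sub>L V t) (at t within {0..T}))" for p
  proof (rule picard_lindelof[OF T L(1), where F = "\<lambda>t W. G' (c (u p t)) o\<^sub>L W"])
    fix W :: "real \<Rightarrow> 'a \<Rightarrow>\<^sub>L 'a" assume "continuous_on {0..T} W"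
    thus "continuous_on {0..T} (\<lambda>t. G' (c (u p t)) o\<^sub>L W t)"
      by (intro continuous_intros bounded_bilinear.continuous_on[OF bounded_bilinear_blinfun_compose]
          continuous_on_compose2[OF contB] continuous_on_compose2[OF c_cont] u_cont) (auto intro: cB)
  next
    fix t and X Y :: "'a \<Rightarrow>\<^sub>L 'a" assume "t \<in> {0..T}"
    have "norm ((G' (c (u p t)) o\<^sub>L X) - (G' (c (u p t)) o\<^sub>L Y)) = norm (G' (c (u p t)) o\<^sub>L (X - Y))"
      by (simp add: bounded_bilinear.diff_right[OF bounded_bilinear_blinfun_compose])
    also have "\<dots> \<le> norm (G' (c (u p t))) * norm (X - Y)" by (rule norm_blinfun_compose)
    also have "\<dots> \<le> L * norm (X - Y)" by (intro mult_right_mono L cB) auto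
    finally show "norm ((G' (c (u p t)) o\<^sub>L X) - (G' (c (u p t)) o\<^sub>L Y)) \<le> L * norm (X - Y)" .
  qed
  then obtain V where V0: "\<And>p. V p 0 = id_blinfun"
    and V: "\<And>p t. t \<in> {0..T} \<Longrightarrow>
      (V p has_vector_derivative G' (c (u p t)) o\<^sub>L V p t) (at t within {0..T})"
    by metis
  define C where "C = exp (L * T)"
  have C: "C \<ge> 1" using L T by (simp add: C_def)
  have Ct: "exp (L * t) \<le> C" if "t \<in> {0..T}" for t using that L by (simp add: C_def)
  have u_lip: "norm (u q t - u p t) \<le> C * norm (q - p)" if t: "t \<in> {0..T}" for p q t
  proof -
    have "norm (u q t - u p t) \<le> (norm (u q 0 - u p 0) + 0 * t) * exp (L * t)"
      by (rule gronwall[OF has_vector_derivative_diff[OF u u] _ _ _ t])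
        (use L G_lip in auto)
    also have "\<dots> \<le> norm (q - p) * C" using Ct[OF t] by (simp add: u0 mult_left_mono)
    finally show ?thesis by (simp add: mult.commute)
  qed
  have V_bound: "norm (V p t) \<le> C" if t: "t \<in> {0..T}" for p t
  proof -
    have "norm (V p t) \<le> (norm (V p 0) + 0 * t) * exp (L * t)"
    proof (rule gronwall[OF V _ _ _ t])
      fix s
      have "norm (G' (c (u p s)) o\<^sub>L V p s) \<le> norm (G' (c (u p s))) * norm (V p s)"
        by (rule norm_blinfun_compose)
      also have "\<dots> \<le> L * norm (V p s)" by (intro mult_right_mono L cB) auto
      finally show "norm (G' (c (u p s)) o\<^sub>L V p s) \<le> L * norm (V p s) + 0" by simp
    qed (use L in auto)
    also have "\<dots> \<le> 1 * C"
      using Ct[OF t] norm_blinfun_id_le by (auto simp: V0 intro!: mult_mono)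
    finally show ?thesis by simp
  qed
  have u_p0: "u p0 t = p0" if t: "t \<in> {0..T}" for t
  proof -
    have "norm (u p0 t - p0) \<le> (norm (u p0 0 - p0) + 0 * t) * exp (L * t)"
    proof (rule gronwall[OF has_vector_derivative_diff[OF u has_vector_derivative_const] _ _ _ t])
      fix s
      show "norm (G (c (u p0 s)) - 0) \<le> L * norm (u p0 s - p0) + 0"
        using G_lip[of "u p0 s" p0] equilibrium by (simp add: c_id B)
    qed (use L in auto)
    thus ?thesis by (simp add: u0)
  qed
  define \<delta> where "\<delta> = r / C"
  have \<delta>: "\<delta> > 0" using r C by (simp add: \<delta>_def)
  have u_in: "u p t \<in> ball p0 r" if "p \<in> ball p0 \<delta>" "t \<in> {0..T}" for p t
  proof -
    have "norm (u p t - u p0 t) \<le> C * norm (p - p0)" by (rule u_lip[OF that(2)])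
    also have "\<dots> < C * \<delta>" using that(1) C by (simp add: dist_norm norm_minus_commute)
    finally show ?thesis using C u_p0[OF that(2)] by (simp add: \<delta>_def dist_norm norm_minus_commute)
  qed
  have UC: "\<exists>\<rho>>0. \<forall>x\<in>B. \<forall>y\<in>B. norm (x - y) < \<rho> \<longrightarrow> norm (G' x - G' y) \<le> \<kappa>" if "\<kappa> > 0" for \<kappa>
    using compact_uniformly_continuous[OF contB B(4)] that
    unfolding uniformly_continuous_on_def dist_norm by (metis less_imp_le norm_minus_commute)
  have taylor: "norm (G y - G x - G' x (y - x)) \<le> norm (y - x) * \<kappa>"
    if "x \<in> B" "y \<in> B" "norm (x - y) < \<rho>"
      and \<rho>: "\<forall>x\<in>B. \<forall>y\<in>B. norm (x - y) < \<rho> \<longrightarrow> norm (G' x - G' y) \<le> \<kappa>" for x y \<rho> \<kappa>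
  proof (rule differentiable_bound_linearization[where S = "closed_segment x y" and f' = "\<lambda>p. blinfun_apply (G' p)"])
    have sB: "closed_segment x y \<subseteq> B" using that B by (simp add: closed_segment_subset)
    show "x + t *\<^sub>R (y - x) \<in> closed_segment x y" if "t \<in> {0..1}" for t
      using that by (auto simp: closed_segment_def algebra_simps intro!: exI[of _ t])
    show "(G has_derivative blinfun_apply (G' p)) (at p within closed_segment x y)"
      if "p \<in> closed_segment x y" for p
      using that sB by (intro derB) auto
    show "onorm (blinfun_apply (G' p) - blinfun_apply (G' x)) \<le> \<kappa>" if p: "p \<in> closed_segment x y" for p
    proof -
      have "norm (p - x) < \<rho>" using segment_bound1[OF p] \<open>norm (x - y) < \<rho>\<close> by (simp add: norm_minus_commute)
      hence "norm (G' p - G' x) \<le> \<kappa>" using \<rho> p sB \<open>x \<in> B\<close> by blast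
      thus ?thesis by (simp add: norm_blinfun.rep_eq minus_blinfun.rep_eq fun_diff_def)
    qed
  qed auto
  have der: "((\<lambda>q. u q t) has_derivative blinfun_apply (V p t)) (at p)"
    if p: "p \<in> ball p0 \<delta>" and t: "t \<in> {0..T}" for p t
    unfolding has_derivative_at_alt
  proof (intro conjI allI impI)
    show "bounded_linear (blinfun_apply (V p t))" by (rule blinfun.bounded_linear_right)
    fix e :: real assume e: "e > 0"
    \<comment> \<open>The remainder solves a linear equation with forcing at most \<open>\<kappa> C norm (q - p)\<close>, so that it ends up
      below \<open>\<kappa> C (T + 1) C norm (q - p)\<close>. The summand 1 covers the case \<open>T = 0\<close>.\<close>
    define \<kappa> where "\<kappa> = e / (C * C * (T + 1))"
    have \<kappa>: "\<kappa> > 0" using e C T by (simp add: \<kappa>_def)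
    obtain \<rho> where \<rho>: "\<rho> > 0" "\<forall>x\<in>B. \<forall>y\<in>B. norm (x - y) < \<rho> \<longrightarrow> norm (G' x - G' y) \<le> \<kappa>"
      using UC[OF \<kappa>] by blast
    obtain d1 where d1: "d1 > 0" "ball p d1 \<subseteq> ball p0 \<delta>"
      using p open_ball open_contains_ball by blast
    define d where "d = min d1 (\<rho> / C)"
    have "d > 0" using d1 \<rho> C by (simp add: d_def)
    moreover have "norm (u q t - u p t - V p t (q - p)) \<le> e * norm (q - p)" if q: "norm (q - p) < d" for q
    proof -
      have qin: "q \<in> ball p0 \<delta>"
        using q d1 by (auto simp: d_def dist_norm norm_minus_commute)
      define w where "w s = u q s - u p s - V p s (q - p)" for s
      have "norm (w t) \<le> (norm (w 0) + \<kappa> * C * norm (q - p) * t) * exp (L * t)"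
      proof (rule gronwall[OF _ _ _ _ t])
        fix s assume s: "s \<in> {0..T}"
        show "(w has_vector_derivative
          G (c (u q s)) - G (c (u p s)) - (G' (c (u p s)) o\<^sub>L V p s) (q - p)) (at s within {0..T})"
          unfolding w_def
          by (intro has_vector_derivative_diff u s
              bounded_linear.has_vector_derivative[OF blinfun.bounded_linear_left V])
        have qB: "u q s \<in> B" "u p s \<in> B" using u_in[OF qin s] u_in[OF p s] by (auto simp: B_def)
        have close: "norm (u p s - u q s) < \<rho>"
        proof -
          have "norm (u q s - u p s) \<le> C * norm (q - p)" by (rule u_lip[OF s])
          also have "\<dots> < C * (\<rho> / C)" using q C by (intro mult_strict_left_mono) (auto simp: d_def)
          finally show ?thesis using C by (simp add: norm_minus_commute)
        qed
        have "G (c (u q s)) - G (c (u p s)) - (G' (c (u p s)) o\<^sub>L V p s) (q - p) =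
          (G (u q s) - G (u p s) - G' (u p s) (u q s - u p s)) + G' (u p s) (w s)"
          by (simp add: w_def c_id qB blinfun.bilinear_simps)
        also have "norm \<dots> \<le> norm (u q s - u p s) * \<kappa> + L * norm (w s)"
        proof (rule norm_triangle_mono)
          show "norm (G (u q s) - G (u p s) - G' (u p s) (u q s - u p s)) \<le> norm (u q s - u p s) * \<kappa>"
            by (rule taylor[OF qB(2,1) close \<rho>(2)])
          have "norm (G' (u p s) (w s)) \<le> norm (G' (u p s)) * norm (w s)" by (rule norm_blinfun)
          also have "\<dots> \<le> L * norm (w s)" by (intro mult_right_mono L qB) auto
          finally show "norm (G' (u p s) (w s)) \<le> L * norm (w s)" .
        qed
        also have "norm (u q s - u p s) * \<kappa> \<le> (C * norm (q - p)) * \<kappa>"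
          using \<kappa> u_lip[OF s] by (intro mult_right_mono) auto
        finally show "norm (G (c (u q s)) - G (c (u p s)) - (G' (c (u p s)) o\<^sub>L V p s) (q - p))
          \<le> L * norm (w s) + \<kappa> * C * norm (q - p)" by (simp add: algebra_simps)
      qed (use L \<kappa> C in auto)
      also have "\<dots> = \<kappa> * C * norm (q - p) * t * exp (L * t)" by (simp add: w_def u0 V0)
      also have "\<dots> \<le> \<kappa> * C * norm (q - p) * (T + 1) * C"
        using t \<kappa> C Ct[OF t] by (intro mult_mono) auto
      also have "\<dots> = (\<kappa> * (C * C * (T + 1))) * norm (q - p)" by (simp add: algebra_simps)
      also have "\<kappa> * (C * C * (T + 1)) = e" using C T by (simp add: \<kappa>_def)
      finally show ?thesis by (simp add: w_def)
    qed
    ultimately show "\<exists>d>0. \<forall>q. norm (q - p) < d \<longrightarrow>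
      norm (u q t - u p t - V p t (q - p)) \<le> e * norm (q - p)" by blast
  qed
  have lim: "((\<lambda>p. V p t) \<longlongrightarrow> V p0 t) (at p0)" if t: "t \<in> {0..T}" for t
  proof (rule tendstoI)
    fix e :: real assume e: "e > 0"
    define \<kappa> where "\<kappa> = e / (2 * (C * C * (T + 1)))"
    have \<kappa>: "\<kappa> > 0" using e C T by (simp add: \<kappa>_def)
    obtain \<rho> where \<rho>: "\<rho> > 0" "\<forall>x\<in>B. \<forall>y\<in>B. norm (x - y) < \<rho> \<longrightarrow> norm (G' x - G' y) \<le> \<kappa>"
      using UC[OF \<kappa>] by blast
    have "dist (V p t) (V p0 t) < e" if pd: "dist p p0 < min \<delta> (\<rho> / C)" for p
    proof -
      have pin: "p \<in> ball p0 \<delta>" using pd by (simp add: dist_commute)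
      define w where "w s = V p s - V p0 s" for s
      have "norm (w t) \<le> (norm (w 0) + \<kappa> * C * t) * exp (L * t)"
      proof (rule gronwall[OF _ _ _ _ t])
        fix s assume s: "s \<in> {0..T}"
        show "(w has_vector_derivative
          (G' (c (u p s)) o\<^sub>L V p s) - (G' (c (u p0 s)) o\<^sub>L V p0 s)) (at s within {0..T})"
          unfolding w_def by (intro has_vector_derivative_diff V s)
        have inB: "u p s \<in> B" using u_in[OF pin s] by (auto simp: B_def)
        have "norm (u p s - u p0 s) \<le> C * norm (p - p0)" by (rule u_lip[OF s])
        also have "\<dots> < C * (\<rho> / C)" using pd C by (intro mult_strict_left_mono) (auto simp: dist_norm)
        finally have "norm (u p s - p0) < \<rho>" using C u_p0[OF s] by simp
        hence close: "norm (G' (u p s) - G' p0) \<le> \<kappa>" using \<rho> inB B by blast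
        have "(G' (c (u p s)) o\<^sub>L V p s) - (G' (c (u p0 s)) o\<^sub>L V p0 s) =
          ((G' (u p s) - G' p0) o\<^sub>L V p s) + (G' p0 o\<^sub>L w s)"
          by (simp add: w_def c_id inB B u_p0[OF s]
              bounded_bilinear.diff_right[OF bounded_bilinear_blinfun_compose]
              bounded_bilinear.diff_left[OF bounded_bilinear_blinfun_compose])
        also have "norm \<dots> \<le> \<kappa> * C + L * norm (w s)"
        proof (rule norm_triangle_mono)
          have "norm ((G' (u p s) - G' p0) o\<^sub>L V p s) \<le> norm (G' (u p s) - G' p0) * norm (V p s)"
            by (rule norm_blinfun_compose)
          also have "\<dots> \<le> \<kappa> * C" using close V_bound[OF s] \<kappa> by (intro mult_mono) auto
          finally show "norm ((G' (u p s) - G' p0) o\<^sub>L V p s) \<le> \<kappa> * C" .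
          have "norm (G' p0 o\<^sub>L w s) \<le> norm (G' p0) * norm (w s)" by (rule norm_blinfun_compose)
          also have "\<dots> \<le> L * norm (w s)" by (intro mult_right_mono L B) auto
          finally show "norm (G' p0 o\<^sub>L w s) \<le> L * norm (w s)" .
        qed
        finally show "norm ((G' (c (u p s)) o\<^sub>L V p s) - (G' (c (u p0 s)) o\<^sub>L V p0 s))
          \<le> L * norm (w s) + \<kappa> * C" by simp
      qed (use L \<kappa> C in auto)
      also have "\<dots> = \<kappa> * C * t * exp (L * t)" by (simp add: w_def V0)
      also have "\<dots> \<le> \<kappa> * C * (T + 1) * C"
        using t \<kappa> C Ct[OF t] by (intro mult_mono) auto
      also have "\<dots> = \<kappa> * (2 * (C * C * (T + 1))) / 2" by (simp add: algebra_simps)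
      also have "\<kappa> * (2 * (C * C * (T + 1))) = e"
      proof -
        have "2 * (C * C * (T + 1)) \<noteq> 0" using C T by simp
        thus ?thesis unfolding \<kappa>_def by (rule nonzero_eq_divide_eq[THEN iffD1]) simp
      qed
      finally have "norm (w t) \<le> e / 2" .
      hence "norm (w t) < e" using e by linarith
      thus ?thesis by (simp add: w_def dist_norm)
    qed
    moreover have "min \<delta> (\<rho> / C) > 0" using \<delta> \<rho> C by simp
    ultimately show "\<forall>\<^sub>F p in at p0. dist (V p t) (V p0 t) < e"
      unfolding eventually_at by blast
  qed
  show thesis
  proof (rule that[of \<delta> u V])
    show "u p t \<in> S" if "p \<in> ball p0 \<delta>" "t \<in> {0..T}" for p t
      using u_in[OF that] rS by auto
    show "(u p has_vector_derivative G (u p t)) (at t within {0..T})"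
      if "p \<in> ball p0 \<delta>" "t \<in> {0..T}" for p t
      using u[OF that(2), of p] u_in[OF that] by (simp add: c_id B_def)
    show "(V p0 has_vector_derivative G' p0 o\<^sub>L V p0 t) (at t within {0..T})" if "t \<in> {0..T}" for t
      using V[OF that, of p0] u_p0[OF that] by (simp add: c_id B)
  qed (use \<delta> u0 V0 der lim in auto)
qed

section \<open>Spectra of combinations of matrix exponentials\<close>

text \<open>The vector \<open>p(M) v\<close>, computed by Horner's scheme, which makes its algebraic properties inductions
  on the list of coefficients.\<close>

definition poly_apply :: "complex^'n^'n \<Rightarrow> complex poly \<Rightarrow> complex^'n \<Rightarrow> complex^'n" where
  "poly_apply M p v = fold_coeffs (\<lambda>a w. a *s v + M *v w) p 0"

lemma poly_apply_0 [simp]: "poly_apply M 0 v = 0"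
  by (simp add: poly_apply_def)

lemma poly_apply_pCons [simp]: "poly_apply M (pCons a p) v = a *s v + M *v poly_apply M p v"
  by (cases "p = 0"; cases "a = 0") (simp_all add: poly_apply_def)

lemma poly_apply_add: "poly_apply M (p + q) v = poly_apply M p v + poly_apply M q v"
  by (induction p q rule: poly_induct2)
    (simp_all add: matrix_vector_right_distrib vector_sadd_rdistrib algebra_simps)

lemma poly_apply_smult: "poly_apply M (smult a p) v = a *s poly_apply M p v"
  by (induction p) (simp_all add: vector_scalar_commute vector_add_ldistrib)

lemma poly_apply_monom: "poly_apply M (monom c i) v = c *s (((*v) M ^^ i) v)"
  by (induction i) (simp_all add: monom_0 monom_Suc vector_scalar_commute)

lemma poly_apply_sum: "poly_apply M (\<Sum>i\<in>I. p i) v = (\<Sum>i\<in>I. poly_apply M (p i) v)"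
  by (induction I rule: infinite_finite_induct) (simp_all add: poly_apply_add)

lemma poly_apply_linear_factor:
  "poly_apply M ([:-z, 1:] * q) v = M *v poly_apply M q v - z *s poly_apply M q v"
proof -
  have "[:-z, 1:] * q = smult (-z) q + pCons 0 q" by simp
  thus ?thesis by (simp only: poly_apply_add poly_apply_smult poly_apply_pCons) simp
qed

lemma poly_apply_eigenvector:
  assumes "M ** N = N ** M" "N *v v = \<mu> *s v"
  shows "N *v poly_apply M p v = \<mu> *s poly_apply M p v"
proof (induction p)
  case (pCons a p)
  have "N *v (M *v poly_apply M p v) = M *v (N *v poly_apply M p v)"
    by (simp add: matrix_vector_mul_assoc assms(1))
  thus ?case
    by (simp add: matrix_vector_right_distrib vector_scalar_commute assms(2) pCons.IH
        vector_add_ldistrib vector_smult_assoc mult.commute)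
qed simp

text \<open>The \<open>CARD('n) + 1\<close> vectors \<open>v, M v, M\<^sup>2 v, \<dots>\<close> are linearly dependent.\<close>

lemma annihilating_poly:
  fixes M :: "complex^'n^'n"
  obtains p where "p \<noteq> 0" "poly_apply M p v = 0"
proof -
  define x where "x i = ((*v) M ^^ i) v" for i
  define n where "n = CARD('n)"
  show thesis
  proof (cases "inj_on x {..n}")
    case False
    then obtain i j where ij: "i \<noteq> j" "x i = x j" by (auto simp: inj_on_def)
    have "poly_apply M (monom 1 i + monom (-1) j) v = 0"
      using ij by (simp add: poly_apply_add poly_apply_monom x_def[symmetric])
    moreover have "coeff (monom 1 i + monom (-1::complex) j) i = 1" using ij by simp
    hence "monom 1 i + monom (-1::complex) j \<noteq> 0" by (metis coeff_0 zero_neq_one)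
    ultimately show thesis using that by blast
  next
    case True
    have "vec.dependent (x ` {..n})"
    proof (rule ccontr)
      assume "\<not> vec.dependent (x ` {..n})"
      hence "card (x ` {..n}) \<le> vec.dim (x ` {..n})" using vec.independent_bound_general by blast
      also have "\<dots> \<le> n" using vec.dim_subset_UNIV by (simp add: n_def vec.dimension_def card_cart_basis)
      finally show False using card_image[OF True] by simp
    qed
    then obtain u where u: "\<exists>w\<in>x ` {..n}. u w \<noteq> 0" "(\<Sum>w\<in>x ` {..n}. u w *s w) = 0"
      by (auto simp: vec.dependent_finite)
    define p where "p = (\<Sum>i\<le>n. monom (u (x i)) i)"
    have "poly_apply M p v = 0"
      using u(2) True by (simp add: p_def poly_apply_sum poly_apply_monom x_def[symmetric] sum.reindex)
    moreover obtain i where "i \<le> n" "u (x i) \<noteq> 0" using u(1) by auto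
    hence "coeff p i \<noteq> 0" by (simp add: p_def coeff_sum coeff_monom)
    hence "p \<noteq> 0" by auto
    ultimately show thesis using that by blast
  qed
qed

text \<open>If \<open>p\<close> has least degree among the nonzero polynomials with \<open>p(M) v = 0\<close>, and \<open>z\<close> is a root of \<open>p\<close>,
  then dividing by the linear factor leaves a nonzero vector that \<open>M - z\<close> kills. Being of the form
  \<open>q(M) v\<close>, it remains in the eigenspace of \<open>N\<close>. This is what turns commutation into a spectral
  mapping theorem without any diagonalizability.\<close>

lemma common_eigenvector:
  fixes M N :: "complex^'n^'n"
  assumes comm: "M ** N = N ** M" and v: "N *v v = \<mu> *s v" "v \<noteq> 0"
  obtains z w where "w \<noteq> 0" "M *v w = z *s w" "N *v w = \<mu> *s w"
proof -
  define P where "P p \<longleftrightarrow> p \<noteq> 0 \<and> poly_apply M p v = 0" for p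
  have "\<exists>p. P p" using annihilating_poly[of M v] unfolding P_def by blast
  then obtain p where p: "P p" and min: "\<And>q. P q \<Longrightarrow> degree p \<le> degree q"
    using exists_least_iff[of "\<lambda>n. \<exists>p. P p \<and> degree p = n"] by (metis not_le)
  have "degree p \<noteq> 0"
  proof
    assume "degree p = 0"
    then obtain a where "p = [:a:]" by (auto elim: degree_eq_zeroE)
    thus False using p v by (auto simp: P_def)
  qed
  then obtain z where "poly p z = 0"
    using fundamental_theorem_of_algebra[of p] by (auto simp: constant_degree)
  then obtain q where q: "p = [:-z, 1:] * q" by (auto simp: poly_eq_0_iff_dvd elim: dvdE)
  have "q \<noteq> 0" using p q by (auto simp: P_def)
  hence "degree q < degree p" unfolding q by (subst degree_mult_eq) auto
  hence "poly_apply M q v \<noteq> 0" using min[of q] \<open>q \<noteq> 0\<close> by (auto simp: P_def)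
  moreover have "M *v poly_apply M q v = z *s poly_apply M q v"
    using p unfolding P_def q poly_apply_linear_factor by simp
  ultimately show thesis using that poly_apply_eigenvector[OF comm v(1)] by blast
qed

lemma mat_vector_mult: "mat z *v v = z *s v"
  by (simp add: vec_eq_iff matrix_vector_mult_def mat_def mult_delta_left)

lemma spectrum_eq_range_eigenvalue_list:
  assumes "eigenvalue_list A lam"
  shows "spectrum A = range lam"
proof -
  have "z \<in> spectrum A \<longleftrightarrow> z \<in> range lam" for z
  proof -
    have "z \<in> spectrum A \<longleftrightarrow> (\<exists>v. v \<noteq> 0 \<and> (mat z - complexify A) *v v = 0)"
    proof -
      have "(mat z - complexify A) *v v = 0 \<longleftrightarrow> complexify A *v v = z *s v" for v
        unfolding matrix_vector_mult_diff_rdistrib mat_vector_mult right_minus_eq by (rule eq_commute)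
      thus ?thesis unfolding spectrum_def by simp
    qed
    also have "\<dots> \<longleftrightarrow> det (mat z - complexify A) = 0"
      using invertible_det_nz[of "mat z - complexify A"] invertible_left_inverse[of "mat z - complexify A"]
        matrix_left_invertible_ker[of "mat z - complexify A"] by auto
    also have "\<dots> \<longleftrightarrow> z \<in> range lam"
      using assms by (auto simp: eigenvalue_list_def)
    finally show ?thesis .
  qed
  thus ?thesis by blast
qed

lemma complexify_mult: "complexify (A ** B) = complexify A ** complexify B"
  by (simp add: vec_eq_iff matrix_matrix_mult_def)

lemma complexify_linear_combination:
  "complexify (\<Sum>i\<in>I. c i *\<^sub>R X i) *v v = (\<Sum>i\<in>I. complex_of_real (c i) *s (complexify (X i) *v v))"
proof -
  have "(complexify (\<Sum>i\<in>I. c i *\<^sub>R X i) *v v) $ k = (\<Sum>i\<in>I. complex_of_real (c i) *s (complexify (X i) *v v)) $ k" for k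
    unfolding matrix_vector_mult_def
    by (simp add: sum_distrib_right sum_distrib_left mult.assoc) (rule sum.swap)
  thus ?thesis by (simp add: vec_eq_iff)
qed

lemma scaleR_eq_vector_mult: "r *\<^sub>R (v :: complex^'n) = complex_of_real r *s v"
  by (simp add: vec_eq_iff complex_eq_iff)

text \<open>The solution of \<open>X' = B X\<close>, \<open>X 0 = 1\<close> is the matrix exponential. The two properties of it that
  determine the spectrum follow from uniqueness: both sides of each equation solve the same linear
  differential equation with the same initial value.\<close>

lemma
  fixes X :: "real \<Rightarrow> real^'n^'n"
  assumes X0: "X 0 = mat 1"
    and X: "\<And>t. t \<in> {0..T} \<Longrightarrow> (X has_vector_derivative B ** X t) (at t within {0..T})"
    and t: "t \<in> {0..T}"
  shows matrix_flow_eigenvector: "complexify B *v v = z *s v \<Longrightarrow>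
      complexify (X t) *v v = exp (of_real t * z) *s v"
    and matrix_flow_commute: "X t ** B = B ** X t"
proof -
  assume v: "complexify B *v v = z *s v"
  define w where "w t = complexify (X t) *v v - exp (of_real t * z) *s v" for t
  have "w t = 0"
  proof (rule linear_ode_zero[OF _ _ t])
    have "linear (\<lambda>u. complexify B *v u)"
      by (rule linearI)
        (simp_all add: matrix_vector_right_distrib scaleR_eq_vector_mult vector_scalar_commute)
    thus "bounded_linear (\<lambda>u. complexify B *v u)" by (simp add: linear_conv_bounded_linear)
    have "complexify (mat 1 :: real^'n^'n) = mat 1" by (simp add: vec_eq_iff mat_def)
    hence "complexify (mat 1 :: real^'n^'n) *v v = v" by (simp only: matrix_vector_mul_lid)
    thus "w 0 = 0" by (simp add: w_def X0)
    fix t assume t: "t \<in> {0..T}"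
    have "linear (\<lambda>M :: real^'n^'n. complexify M *v v)"
      by (rule linearI) (simp_all add: vec_eq_iff matrix_vector_mult_def scaleR_eq_vector_mult
          sum_distrib_left algebra_simps sum.distrib)
    hence 1: "((\<lambda>t. complexify (X t) *v v) has_vector_derivative complexify (B ** X t) *v v) (at t within {0..T})"
      unfolding linear_conv_bounded_linear by (rule bounded_linear.has_vector_derivative[OF _ X[OF t]])
    have "linear (\<lambda>c. c *s v)"
      by (rule linearI) (simp_all add: vec_eq_iff algebra_simps)
    moreover have "((\<lambda>t. exp (of_real t * z)) has_vector_derivative z * exp (of_real t * z)) (at t within {0..T})"
      by (rule has_vector_derivative_real_field) (auto intro!: derivative_eq_intros)
    ultimately
    have 2: "((\<lambda>t. exp (of_real t * z) *s v) has_vector_derivative (z * exp (of_real t * z)) *s v) (at t within {0..T})"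
      unfolding linear_conv_bounded_linear by (rule bounded_linear.has_vector_derivative)
    show "(w has_vector_derivative complexify B *v w t) (at t within {0..T})"
      unfolding w_def
      by (rule has_vector_derivative_eq_rhs[OF has_vector_derivative_diff[OF 1 2]])
        (simp add: complexify_mult matrix_vector_mult_diff_distrib matrix_vector_mul_assoc[symmetric]
          vector_scalar_commute v vector_smult_assoc mult.commute)
  qed
  thus "complexify (X t) *v v = exp (of_real t * z) *s v" by (simp add: w_def)
next
  define w where "w t = X t ** B - B ** X t" for t
  have lin: "bounded_linear (\<lambda>M. B ** M)" "bounded_linear (\<lambda>M. M ** B)"
    by (auto simp: linear_conv_bounded_linear[symmetric] vec_eq_iff matrix_matrix_mult_def
        sum_distrib_left algebra_simps sum.distrib intro!: linearI)
  have "w t = 0"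
  proof (rule linear_ode_zero[OF lin(1) _ t])
    show "w 0 = 0" by (simp add: w_def X0)
    fix t assume t: "t \<in> {0..T}"
    show "(w has_vector_derivative B ** w t) (at t within {0..T})"
      unfolding w_def
      by (rule has_vector_derivative_eq_rhs[OF has_vector_derivative_diff[OF
          bounded_linear.has_vector_derivative[OF lin(2) X[OF t]]
          bounded_linear.has_vector_derivative[OF lin(1) X[OF t]]]])
        (simp add: matrix_mul_assoc linear_diff[OF bounded_linear.linear[OF lin(1)]])
  qed
  thus "X t ** B = B ** X t" by (simp add: w_def)
qed

text \<open>The spectral mapping theorem for linear combinations of matrix exponentials. One inclusion holds
  because eigenvectors of \<open>B\<close> are eigenvectors of the combination; for the other, the combination
  commutes with \<open>B\<close>, so each of its eigenvalues has an eigenvector in common with \<open>B\<close>.\<close>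

lemma spectrum_matrix_flow_combination:
  fixes X :: "real \<Rightarrow> real^'n^'n"
  assumes X0: "X 0 = mat 1"
    and X: "\<And>t. t \<in> {0..T} \<Longrightarrow> (X has_vector_derivative B ** X t) (at t within {0..T})"
    and \<tau>: "\<And>i. i \<in> I \<Longrightarrow> \<tau> i \<in> {0..T}"
  shows "spectrum (\<Sum>i\<in>I. c i *\<^sub>R X (\<tau> i)) =
    (\<lambda>z. \<Sum>i\<in>I. of_real (c i) * exp (of_real (\<tau> i) * z)) ` spectrum B"
proof -
  define A where "A = (\<Sum>i\<in>I. c i *\<^sub>R X (\<tau> i))"
  define F where "F z = (\<Sum>i\<in>I. complex_of_real (c i) * exp (of_real (\<tau> i) * z))" for z
  have eig: "complexify A *v v = F z *s v" if "complexify B *v v = z *s v" for z v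
    unfolding A_def complexify_linear_combination F_def
    unfolding vec.scale_sum_left
  proof (intro sum.cong refl)
    fix i assume "i \<in> I"
    hence "complexify (X (\<tau> i)) *v v = exp (of_real (\<tau> i) * z) *s v"
      using matrix_flow_eigenvector[OF X0 X _ that] \<tau> by blast
    thus "complex_of_real (c i) *s (complexify (X (\<tau> i)) *v v) =
        (complex_of_real (c i) * exp (of_real (\<tau> i) * z)) *s v"
      by (simp add: vector_smult_assoc)
  qed
  have lin: "linear (\<lambda>M. B ** M)" "linear (\<lambda>M. M ** B)"
    by (auto simp: vec_eq_iff matrix_matrix_mult_def
        sum_distrib_left algebra_simps sum.distrib intro!: linearI)
  have "B ** A = A ** B"
    unfolding A_def linear_sum[OF lin(1)] linear_sum[OF lin(2)]
    by (intro sum.cong refl)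
      (simp only: linear_cmul[OF lin(1)] linear_cmul[OF lin(2)] matrix_flow_commute[OF X0 X \<tau>])
  hence comm: "complexify B ** complexify A = complexify A ** complexify B"
    by (simp flip: complexify_mult)
  have "spectrum A \<subseteq> F ` spectrum B"
  proof
    fix \<mu> assume "\<mu> \<in> spectrum A"
    then obtain v where "v \<noteq> 0" "complexify A *v v = \<mu> *s v" by (auto simp: spectrum_def)
    then obtain z w where w: "w \<noteq> 0" "complexify B *v w = z *s w" "complexify A *v w = \<mu> *s w"
      using common_eigenvector[OF comm] by metis
    hence "\<mu> *s w = F z *s w" using eig by metis
    hence "\<mu> = F z" using w(1) by simp
    thus "\<mu> \<in> F ` spectrum B" using w by (auto simp: spectrum_def)
  qed
  moreover have "F ` spectrum B \<subseteq> spectrum A" using eig by (auto simp: spectrum_def)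
  ultimately show ?thesis unfolding A_def F_def by blast
qed

section \<open>The amplification function in the left half-plane\<close>

lemma sum_square_split:
  fixes s :: "nat \<Rightarrow> nat \<Rightarrow> real"
  assumes "\<And>j k. s j k = s k j"
  shows "(\<Sum>j=1..n. \<Sum>k=1..n. s j k) = 2 * (\<Sum>j=1..n. \<Sum>k=1..j-1. s j k) + (\<Sum>k=1..n. s k k)"
proof (induction n)
  case (Suc n)
  have "(\<Sum>j=1..n. s j (Suc n)) = (\<Sum>k=1..n. s (Suc n) k)"
    using assms by (intro sum.cong refl)
  thus ?case using Suc by (simp add: sum.distrib)
qed simp

text \<open>The eigenvalue of the leading-order Jacobian that belongs to an eigenvalue \<open>\<lambda>\<close> of the fast
  Jacobian is this function, with \<open>n = m + 1\<close>, at \<open>\<zeta> = \<lambda> H / \<epsilon>\<close>.\<close>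

definition amplification :: "nat \<Rightarrow> complex \<Rightarrow> complex" where
  "amplification n \<zeta> = 1 - (1 - exp \<zeta>) ^ n"

text \<open>Expanding \<open>1 - (1 - w)\<^sup>n\<close> by the binomial theorem, the squared modulus is a double sum over
  \<open>j, k\<close> of products of coefficients times the cosine of a phase difference; its off-diagonal part is
  counted twice.\<close>

lemma stability_rhs_eq_amplification:
  "stability_rhs m Hl t = (cmod (amplification (m + 1) (Complex (- Hl) (- Hl * tan t))))\<^sup>2"
proof -
  define n where "n = m + 1"
  define \<phi> where "\<phi> = Hl * tan t"
  define a where "a k = real (n choose k) * (-1) ^ k * exp (- real k * Hl)" for k
  have ex: "exp (Complex (- Hl) (- Hl * tan t)) = of_real (exp (- Hl)) * cis (- \<phi>)"
    by (simp add: exp_eq_polar \<phi>_def)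
  have "amplification n (Complex (- Hl) (- Hl * tan t)) =
      1 - (\<Sum>k\<le>n. of_nat (n choose k) * (- exp (Complex (- Hl) (- Hl * tan t))) ^ k)"
    unfolding amplification_def
    using binomial_ring[of "- exp (Complex (- Hl) (- Hl * tan t))" 1 n] by simp
  also have "\<dots> = 1 - (\<Sum>k\<le>n. of_real (a k) * cis (- (real k * \<phi>)))"
  proof -
    have "(- exp (Complex (- Hl) (- Hl * tan t))) ^ k =
        of_real ((-1) ^ k * exp (- real k * Hl)) * cis (- (real k * \<phi>))" for k
    proof -
      have "complex_of_real (exp (- Hl)) ^ k = of_real (exp (- real k * Hl))"
        unfolding of_real_power[symmetric] by (simp flip: exp_of_nat_mult)
      moreover have "cis (- \<phi>) ^ k = cis (- (real k * \<phi>))" by (simp only: Complex.DeMoivre mult_minus_right)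
      ultimately show ?thesis unfolding ex by (subst power_minus) (simp add: power_mult_distrib)
    qed
    thus ?thesis by (simp add: a_def mult.assoc)
  qed
  also have "{..n} = insert 0 {1..n}" by auto
  also have "1 - (\<Sum>k\<in>insert 0 {1..n}. of_real (a k) * cis (- (real k * \<phi>))) =
      - (\<Sum>k=1..n. of_real (a k) * cis (- (real k * \<phi>)))"
    by (subst sum.insert) (auto simp: a_def)
  finally have "(cmod (amplification n (Complex (- Hl) (- Hl * tan t))))\<^sup>2 =
      (\<Sum>k=1..n. a k * cos (real k * \<phi>))\<^sup>2 + (\<Sum>k=1..n. a k * sin (real k * \<phi>))\<^sup>2"
    by (simp add: cmod_power2 sum_negf)
  also have "\<dots> = (\<Sum>j=1..n. \<Sum>k=1..n. a j * a k * cos ((real j - real k) * \<phi>))"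
    by (simp add: power2_eq_square sum_product sum.distrib[symmetric] left_diff_distrib cos_diff algebra_simps)
  also have "\<dots> = 2 * (\<Sum>j=1..n. \<Sum>k=1..j-1. a j * a k * cos ((real j - real k) * \<phi>)) +
      (\<Sum>k=1..n. a k * a k * cos ((real k - real k) * \<phi>))"
    by (rule sum_square_split) (metis cos_minus minus_diff_eq minus_mult_left mult.commute)
  also have "(\<Sum>j=1..n. \<Sum>k=1..j-1. a j * a k * cos ((real j - real k) * \<phi>)) =
      (\<Sum>j=1..n. \<Sum>k=1..j-1. real (n choose j) * real (n choose k) * (-1) ^ (j + k) *
            exp (- real (j + k) * Hl) * cos (real (j - k) * Hl * tan t))"
  proof (intro sum.cong refl)
    fix j k assume "j \<in> {1..n}" "k \<in> {1..j - 1}"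
    hence diff: "real j - real k = real (j - k)" by auto
    have exp: "exp (- real (j + k) * Hl) = exp (- real j * Hl) * exp (- real k * Hl)"
      by (simp add: exp_add[symmetric] algebra_simps)
    show "a j * a k * cos ((real j - real k) * \<phi>) =
        real (n choose j) * real (n choose k) * (-1) ^ (j + k) *
            exp (- real (j + k) * Hl) * cos (real (j - k) * Hl * tan t)"
      unfolding diff exp a_def \<phi>_def power_add by (simp only: mult_ac)
  qed
  also have "(\<Sum>k=1..n. a k * a k * cos ((real k - real k) * \<phi>)) =
      (\<Sum>k=1..n. (real (n choose k))\<^sup>2 * exp (- 2 * real k * Hl))"
  proof (intro sum.cong refl)
    fix k
    have "exp (- 2 * real k * Hl) = exp (- real k * Hl) * exp (- real k * Hl)"
      by (simp add: exp_add[symmetric] algebra_simps)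
    moreover have "(-1::real) ^ k * (-1) ^ k = 1" by (simp flip: power_mult_distrib)
    ultimately
    show "a k * a k * cos ((real k - real k) * \<phi>) =
        (real (n choose k))\<^sup>2 * exp (- 2 * real k * Hl)"
      by (simp add: a_def power2_eq_square algebra_simps)
  qed
  finally show ?thesis unfolding stability_rhs_def n_def by simp
qed

lemma amplification_less_1_iff:
  assumes "z = complex_of_real (cmod z) * exp (\<i> * complex_of_real t)" "Re z < 0"
  shows "cmod (amplification (m + 1) (of_real \<sigma> * z)) < 1 \<longleftrightarrow> stability_rhs m (- Re z * \<sigma>) t < 1"
proof -
  have "Re z = cmod z * cos t" "Im z = cmod z * sin t"
    using arg_cong[OF assms(1), of Re] arg_cong[OF assms(1), of Im]
    by (simp_all add: cis_conv_exp[symmetric])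
  hence "Im z = Re z * tan t" using assms(2) by (auto simp: tan_def)
  hence "of_real \<sigma> * z = Complex (- (- Re z * \<sigma>)) (- (- Re z * \<sigma>) * tan t)"
    by (simp add: complex_eq_iff)
  thus ?thesis
    unfolding stability_rhs_eq_amplification by (simp add: abs_square_less_1)
qed

lemma has_field_derivative_amplification:
  "(amplification n has_field_derivative of_nat n * (1 - exp \<zeta>) ^ (n - 1) * exp \<zeta>) (at \<zeta>)"
  unfolding amplification_def by (rule derivative_eq_intros refl)+ simp

text \<open>In the left half-plane \<open>exp \<zeta>\<close> is never 1, so the derivative of the amplification does not
  vanish. Moving in the direction in which the amplification \<open>A\<close> has derivative \<open>- A\<close> lowers its
  modulus at once.\<close>

lemma amplification_descent:
  assumes "n > 0" "Re \<zeta> < 0" "cmod (amplification n \<zeta>) = 1"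
  obtains d where "\<forall>\<^sub>F s in at_right 0. cmod (amplification n (\<zeta> + of_real s * d)) < 1"
proof -
  define D where "D = of_nat n * (1 - exp \<zeta>) ^ (n - 1) * exp \<zeta>"
  define A where "A = amplification n \<zeta>"
  have "cmod (exp \<zeta>) < 1" using assms by simp
  hence "exp \<zeta> \<noteq> 1" by (metis less_irrefl norm_one)
  hence "D \<noteq> 0" using assms by (auto simp: D_def)
  define d where "d = - A / D"
  define q where "q s = (cmod (amplification n (\<zeta> + of_real s * d)))\<^sup>2" for s
  have "((\<lambda>s. amplification n (\<zeta> + of_real s * d)) has_vector_derivative - A) (at 0)"
  proof -
    have "((\<lambda>w. amplification n (\<zeta> + w * d)) has_field_derivative D * d) (at (of_real 0))"
      unfolding D_def
      by (rule DERIV_chain'[where g = "amplification n" and f = "\<lambda>w. \<zeta> + w * d" and D = d, THEN DERIV_cong])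
        (auto intro!: derivative_eq_intros DERIV_cong[OF has_field_derivative_amplification])
    thus ?thesis using \<open>D \<noteq> 0\<close> has_vector_derivative_real_field[of _ "D * d" 0 UNIV] by (simp add: d_def)
  qed
  hence dr: "((\<lambda>s. Re (amplification n (\<zeta> + of_real s * d))) has_real_derivative - Re A) (at 0)"
    and di: "((\<lambda>s. Im (amplification n (\<zeta> + of_real s * d))) has_real_derivative - Im A) (at 0)"
    using has_vector_derivative_complex_iff by fastforce+
  have "(q has_real_derivative - 2 * ((Re A)\<^sup>2 + (Im A)\<^sup>2)) (at 0)"
    unfolding q_def cmod_power2
    by (rule derivative_eq_intros dr di refl)+ (simp add: A_def power2_eq_square algebra_simps)
  moreover have "(Re A)\<^sup>2 + (Im A)\<^sup>2 = 1"
    using assms(3) cmod_power2[of A] by (simp add: A_def)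
  ultimately have "(q has_real_derivative - 2) (at 0)" by simp
  from DERIV_neg_dec_right[OF this] obtain e where e: "e > 0" "\<And>s. 0 < s \<Longrightarrow> s < e \<Longrightarrow> q s < q 0"
    by auto
  have "\<forall>\<^sub>F s in at_right 0. cmod (amplification n (\<zeta> + of_real s * d)) < 1"
    unfolding eventually_at_right_field
  proof (intro exI[of _ e] conjI allI impI)
    fix s :: real assume "0 < s" "s < e"
    hence "q s < 1" using e(2)[of s] assms(3) by (simp add: q_def)
    thus "cmod (amplification n (\<zeta> + of_real s * d)) < 1" by (simp add: q_def abs_square_less_1)
  qed (use e in auto)
  thus thesis using that by blast
qed

text \<open>By continuity, points of the frontier satisfy the implicit equation. Conversely, a solution of the
  equation could fail to be in the frontier only if it were a local minimum of the modulus. The map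
  \<open>(H, t) \<mapsto> - c H (1 + \<i> tan t)\<close> is a homeomorphism of the parameter domain onto the left half-plane,
  and there the modulus 1 is never a local minimum; the curve \<open>\<gamma>\<close> below transports a descending
  segment back to the parameter domain.\<close>

lemma frontier_stability_region:
  assumes "\<epsilon> > 0" "lamR < 0"
  shows "frontier (stability_region m \<epsilon> lamR) \<inter> parameter_domain =
    {(H, t) \<in> parameter_domain. 1 = stability_rhs m (- lamR * H / \<epsilon>) t}"
proof -
  define c where "c = - lamR / \<epsilon>"
  have c: "c > 0" using assms by (simp add: c_def divide_neg_pos)
  define R where "R = stability_region m \<epsilon> lamR"
  define q where "q = (\<lambda>(H, t). stability_rhs m (c * H) t)"
  have R: "R = {p \<in> parameter_domain. q p < 1}"
    by (auto simp: R_def stability_region_def q_def c_def)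
  have op: "open parameter_domain" unfolding parameter_domain_def by (intro open_Times) auto
  have cos: "cos t \<noteq> 0" if "t \<in> {pi/2<..<3*pi/2}" for t
  proof -
    have "cos (t - pi) > 0" using that by (intro cos_gt_zero_pi) auto
    thus ?thesis by (simp add: cos_diff)
  qed
  have "continuous_on parameter_domain (\<lambda>p. tan (snd p))"
    unfolding tan_def
    by (intro continuous_on_divide continuous_on_sin continuous_on_cos continuous_on_snd continuous_on_id)
      (auto simp: parameter_domain_def dest: cos)
  hence cont: "continuous_on parameter_domain q"
    unfolding q_def case_prod_unfold stability_rhs_def
    by (intro continuous_on_add continuous_on_mult continuous_on_sum continuous_on_const
        continuous_on_exp continuous_on_cos continuous_on_fst continuous_on_id)
  have "p \<in> frontier R \<longleftrightarrow> 1 = q p" if p: "p \<in> parameter_domain" for p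
  proof
    assume fr: "p \<in> frontier R"
    have "open R"
    proof -
      have "R = parameter_domain \<inter> q -` {..<1}" by (auto simp: R)
      thus ?thesis using continuous_open_preimage[OF cont op open_lessThan] by simp
    qed
    hence "p \<notin> R" using fr by (simp add: frontier_def interior_open)
    hence "q p \<ge> 1" using p by (auto simp: R)
    moreover have "\<not> q p > 1"
    proof
      assume "q p > 1"
      moreover have "open (parameter_domain \<inter> q -` {1<..})"
        by (rule continuous_open_preimage[OF cont op]) auto
      ultimately have "p \<in> interior (- R)"
        using p by (intro interiorI[of "parameter_domain \<inter> q -` {1<..}"]) (auto simp: R)
      thus False using fr by (simp add: frontier_def interior_complement)
    qed
    ultimately show "1 = q p" by simp
  next
    assume q1: "1 = q p"
    obtain H t where pHt: "p = (H, t)" by (cases p)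
    have H: "H > 0" and t: "t \<in> {pi/2<..<3*pi/2}" using p by (auto simp: pHt parameter_domain_def)
    define \<zeta> where "\<zeta> = Complex (- (c * H)) (- (c * H) * tan t)"
    have re: "Re \<zeta> < 0" using c H by (simp add: \<zeta>_def)
    have "(cmod (amplification (m + 1) \<zeta>))\<^sup>2 = 1"
      using q1 by (simp add: pHt q_def stability_rhs_eq_amplification \<zeta>_def)
    hence "cmod (amplification (m + 1) \<zeta>) = 1" by (simp add: power2_eq_1_iff) (smt (verit) norm_ge_zero)
    then obtain d where d: "\<forall>\<^sub>F s in at_right 0. cmod (amplification (m + 1) (\<zeta> + of_real s * d)) < 1"
      using amplification_descent[OF _ re] by auto
    \<comment> \<open>Angles in the domain lie around \<open>pi\<close>, one period away from the range of \<open>arctan\<close>.\<close>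
    define \<gamma> where "\<gamma> s = (- Re (\<zeta> + of_real s * d) / c,
      arctan (Im (\<zeta> + of_real s * d) / Re (\<zeta> + of_real s * d)) + pi)" for s
    have \<gamma>0: "\<gamma> 0 = p"
    proof -
      have "tan (t - pi) = tan t" using tan_periodic_pi[of "t - pi"] by simp
      hence "arctan (tan t) = t - pi" using t arctan_tan[of "t - pi"] by auto
      thus ?thesis using c H by (simp add: \<gamma>_def \<zeta>_def pHt)
    qed
    have lim: "(\<gamma> \<longlongrightarrow> p) (at_right 0)"
    proof -
      have "isCont \<gamma> 0"
        unfolding \<gamma>_def using re c by (intro continuous_intros) auto
      thus ?thesis using \<gamma>0 by (metis isCont_def filterlim_at_split)
    qed
    have "\<forall>\<^sub>F s in at_right 0. Re (\<zeta> + of_real s * d) < 0"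
    proof -
      have "((\<lambda>s. Re (\<zeta> + of_real s * d)) \<longlongrightarrow> Re (\<zeta> + of_real 0 * d)) (at_right 0)"
        by (intro tendsto_intros)
      thus ?thesis using re by (intro order_tendstoD) auto
    qed
    with d have "\<forall>\<^sub>F s in at_right 0. \<gamma> s \<in> closure R"
    proof eventually_elim
      case (elim s)
      define w where "w = \<zeta> + of_real s * d"
      have "\<gamma> s \<in> parameter_domain"
        using elim c arctan_lbound[of "Im w / Re w"] arctan_ubound[of "Im w / Re w"]
        by (simp add: \<gamma>_def parameter_domain_def w_def[symmetric] divide_neg_pos)
      moreover have "q (\<gamma> s) = (cmod (amplification (m + 1) (Complex (Re w) (Re w * (Im w / Re w)))))\<^sup>2"
        using c by (simp add: q_def \<gamma>_def w_def[symmetric] stability_rhs_eq_amplification tan_arctan)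
      moreover have "Complex (Re w) (Re w * (Im w / Re w)) = w"
        using elim by (simp add: complex_eq_iff w_def)
      ultimately have "\<gamma> s \<in> R" using elim by (simp add: R w_def abs_square_less_1)
      thus ?case using closure_subset by blast
    qed
    hence "p \<in> closure R" by (rule Lim_in_closed_set[OF closed_closure _ _ lim]) simp
    moreover have "p \<notin> R" using q1 by (simp add: R)
    hence "p \<notin> interior R" using interior_subset by blast
    ultimately show "p \<in> frontier R" by (simp add: frontier_def)
  qed
  thus ?thesis unfolding R_def[symmetric] by (auto simp: q_def c_def)
qed

lemma amplification_real_less_1:
  assumes "x < 0" "n > 0"
  shows "cmod (amplification n (of_real x)) < 1"
proof -
  have e: "0 < exp x" "exp x < 1" using assms by auto
  have "amplification n (of_real x) = of_real (1 - (1 - exp x) ^ n)"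
    by (simp add: amplification_def exp_of_real)
  moreover have "0 < (1 - exp x) ^ n" "(1 - exp x) ^ n \<le> 1" using e by (auto intro: power_le_one)
  ultimately show ?thesis by (simp only: norm_of_real)
qed

text \<open>The triangle inequality in the binomial expansion, whose constant term cancels. The bound depends
  on \<open>Re \<zeta>\<close> only, hence is uniform in the angle, and it is below 1 exactly when
  \<open>exp (Re \<zeta>) < 2 powr (1 / n) - 1\<close> (for positive \<open>n\<close>); this is where \<open>H_s\<close> comes from.\<close>

lemma amplification_bound: "cmod (amplification n \<zeta>) \<le> (1 + exp (Re \<zeta>)) ^ n - 1"
proof -
  have "amplification n \<zeta> = - (\<Sum>k=1..n. of_nat (n choose k) * (- exp \<zeta>) ^ k)"
  proof -
    have "(1 - exp \<zeta>) ^ n = (\<Sum>k\<le>n. of_nat (n choose k) * (- exp \<zeta>) ^ k)"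
      using binomial_ring[of "- exp \<zeta>" 1 n] by simp
    also have "{..n} = insert 0 {1..n}" by auto
    finally show ?thesis by (simp add: amplification_def)
  qed
  hence "cmod (amplification n \<zeta>) \<le> (\<Sum>k=1..n. cmod (of_nat (n choose k) * (- exp \<zeta>) ^ k))"
    by (simp only: norm_minus_cancel norm_sum)
  also have "\<dots> = (\<Sum>k=1..n. of_nat (n choose k) * exp (Re \<zeta>) ^ k)"
    by (simp add: norm_mult norm_power)
  also have "\<dots> = (1 + exp (Re \<zeta>)) ^ n - 1"
  proof -
    have "(1 + exp (Re \<zeta>)) ^ n = (\<Sum>k\<le>n. of_nat (n choose k) * exp (Re \<zeta>) ^ k)"
      using binomial_ring[of "exp (Re \<zeta>)" 1 n] by (simp add: add.commute)
    also have "{..n} = insert 0 {1..n}" by auto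
    finally show ?thesis by simp
  qed
  finally show ?thesis .
qed

lemma root_of_2_bounds: "0 < 2 powr (1 / real (m + 1)) - 1" "2 powr (1 / real (m + 1)) - 1 \<le> 1"
proof -
  have "2 powr (1 / real (m + 1)) > 2 powr 0" by (rule powr_less_mono) auto
  thus "0 < 2 powr (1 / real (m + 1)) - 1" by simp
  have "2 powr (1 / real (m + 1)) \<le> 2 powr 1" by (rule powr_mono) auto
  thus "2 powr (1 / real (m + 1)) - 1 \<le> 1" by simp
qed

lemma H_s_nonneg: "0 \<le> H_s m"
  unfolding H_s_def using root_of_2_bounds[of m] by simp

lemma amplification_less_1_of_H_s:
  assumes "Re \<zeta> < - H_s m"
  shows "cmod (amplification (m + 1) \<zeta>) < 1"
proof -
  have "exp (Re \<zeta>) < exp (- H_s m)" using assms by simp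
  also have "\<dots> = 2 powr (1 / real (m + 1)) - 1"
    unfolding H_s_def using root_of_2_bounds[of m] by simp
  finally have "(1 + exp (Re \<zeta>)) ^ (m + 1) < (2 powr (1 / real (m + 1))) ^ (m + 1)"
    by (intro power_strict_mono) (auto simp: add_nonneg_nonneg)
  also have "\<dots> = 2" by (simp add: powr_realpow[symmetric] powr_powr del: power_Suc)
  finally show ?thesis using amplification_bound[of "m + 1" \<zeta>] by linarith
qed

section \<open>The leading-order Jacobian of the iteration\<close>

text \<open>The system in the fast time \<open>t / \<epsilon>\<close>, with \<open>\<epsilon>\<close> as an additional constant state variable. The
  limit \<open>\<epsilon> \<rightarrow> 0\<close> then is a limit of initial points towards the equilibrium \<open>(x0, hc 0 x0, 0)\<close> of a
  single smooth field.\<close>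

definition extended_field ::
  "(real^'s \<Rightarrow> real^'f \<Rightarrow> real \<Rightarrow> real^'s) \<Rightarrow> (real^'s \<Rightarrow> real^'f \<Rightarrow> real \<Rightarrow> real^'f) \<Rightarrow>
   (real^'s) \<times> (real^'f) \<times> real \<Rightarrow> (real^'s) \<times> (real^'f) \<times> real" where
  "extended_field f g = (\<lambda>(x, y, \<epsilon>). (\<epsilon> *\<^sub>R f x y \<epsilon>, g x y \<epsilon>, 0))"

text \<open>The block of a linear map of the extended state space that describes the response of the fast
  component to a perturbation of the fast component.\<close>

definition fast_block ::
  "((real^'s) \<times> (real^'f) \<times> real) \<Rightarrow>\<^sub>L ((real^'s) \<times> (real^'f) \<times> real) \<Rightarrow> real^'f^'f" where
  "fast_block W = matrix (\<lambda>b. fst (snd (W (0, b, 0))))"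

lemma fast_block_mult:
  fixes W :: "((real^'s) \<times> (real^'f) \<times> real) \<Rightarrow>\<^sub>L ((real^'s) \<times> (real^'f) \<times> real)"
  shows "fast_block W *v b = fst (snd (W (0, b, 0)))"
proof -
  have "linear (\<lambda>b. fst (snd (W (0, b, 0))))"
  proof (rule linearI)
    fix b1 b2 :: "real^'f" and r :: real
    have e: "(0 :: real^'s, b1 + b2, 0 :: real) = (0, b1, 0) + (0, b2, 0)"
      "(0 :: real^'s, r *\<^sub>R b1, 0 :: real) = r *\<^sub>R (0, b1, 0)" by auto
    show "fst (snd (W (0, b1 + b2, 0))) = fst (snd (W (0, b1, 0))) + fst (snd (W (0, b2, 0)))"
      unfolding e(1) blinfun.add_right by simp
    show "fst (snd (W (0, r *\<^sub>R b1, 0))) = r *\<^sub>R fst (snd (W (0, b1, 0)))"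
      unfolding e(2) blinfun.scaleR_right by simp
  qed
  thus ?thesis by (simp add: fast_block_def matrix_works)
qed

text \<open>The argument ranges over operators, not over a Euclidean space, where linearity would imply
  boundedness. Writing the block as a finite sum of linear images of values at basis vectors reduces
  the claim to the boundedness of evaluation.\<close>

lemma bounded_linear_fast_block:
  "bounded_linear (fast_block :: _ \<Rightarrow>\<^sub>L ((real^'s) \<times> (real^'f) \<times> real) \<Rightarrow> _)"
proof -
  define K where "K j p = (\<chi> i k. if k = j then fst (snd p) $ i else 0 :: real^'f^'f)"
    for j and p :: "(real^'s) \<times> (real^'f) \<times> real"
  have "bounded_linear (K j)" for j
    unfolding linear_conv_bounded_linear[symmetric]
    by (rule linearI) (auto simp: K_def vec_eq_iff)
  hence "bounded_linear (\<lambda>W :: ((real^'s) \<times> (real^'f) \<times> real) \<Rightarrow>\<^sub>L _. \<Sum>j\<in>UNIV. K j (W (0, axis j 1, 0)))"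
    by (intro bounded_linear_sum bounded_linear_compose[OF _ blinfun.bounded_linear_left])
  moreover have "fast_block = (\<lambda>W. \<Sum>j\<in>UNIV. K j (W (0, axis j 1, 0)))"
    by (auto simp: fun_eq_iff vec_eq_iff fast_block_def matrix_def K_def)
  ultimately show ?thesis by simp
qed

lemma smooth_on_frechet_derivative:
  assumes "smooth_on S F" "p \<in> S"
  shows "(F has_derivative frechet_derivative F (at p)) (at p)"
proof -
  have "Ck_on (Suc 0) S F" using assms(1) by (simp only: smooth_on_def)
  thus ?thesis using assms(2) frechet_derivative_works by auto
qed

lemma smooth_on_continuous_frechet_derivative:
  assumes "smooth_on S F"
  shows "continuous_on S (\<lambda>p. frechet_derivative F (at p) v)"
proof -
  have "Ck_on (Suc 0) S F" using assms by (simp only: smooth_on_def)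
  thus ?thesis by auto
qed

lemma smooth_on_continuous: "smooth_on S F \<Longrightarrow> continuous_on S F"
  unfolding smooth_on_def by (metis Ck_on.simps(1))

lemma extended_field_derivative:
  fixes f :: "real^'s \<Rightarrow> real^'f \<Rightarrow> real \<Rightarrow> real^'s" and g :: "real^'s \<Rightarrow> real^'f \<Rightarrow> real \<Rightarrow> real^'f"
  defines "ff \<equiv> \<lambda>(x, y, \<epsilon>). f x y \<epsilon>" and "gg \<equiv> \<lambda>(x, y, \<epsilon>). g x y \<epsilon>"
  assumes f: "smooth_on S ff" and g: "smooth_on S gg"
  obtains G' where
    "\<And>p. p \<in> S \<Longrightarrow> (extended_field f g has_derivative blinfun_apply (G' p)) (at p)"
    "continuous_on S G'"
    "\<And>p v. p \<in> S \<Longrightarrow> G' p v = (snd (snd v) *\<^sub>R ff p + snd (snd p) *\<^sub>R frechet_derivative ff (at p) v,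
       frechet_derivative gg (at p) v, 0)"
proof -
  define D where "D p v = (snd (snd v) *\<^sub>R ff p + snd (snd p) *\<^sub>R frechet_derivative ff (at p) v,
       frechet_derivative gg (at p) v, 0 :: real)" for p v
  define G' where "G' p = Blinfun (D p)" for p
  have E: "extended_field f g = (\<lambda>p. (snd (snd p) *\<^sub>R ff p, gg p, 0))"
    by (auto simp: extended_field_def ff_def gg_def)
  have der: "(extended_field f g has_derivative D p) (at p)" if "p \<in> S" for p
  proof -
    have "((\<lambda>p. (snd (snd p) *\<^sub>R ff p, gg p, 0)) has_derivative
        (\<lambda>v. (snd (snd p) *\<^sub>R frechet_derivative ff (at p) v + snd (snd v) *\<^sub>R ff p,
          frechet_derivative gg (at p) v, 0))) (at p)"
      by (intro has_derivative_Pair has_derivative_scaleR has_derivative_snd has_derivative_ident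
          has_derivative_const smooth_on_frechet_derivative[OF f that] smooth_on_frechet_derivative[OF g that])
    thus ?thesis unfolding E D_def by (simp add: add.commute)
  qed
  have G': "blinfun_apply (G' p) = D p" if "p \<in> S" for p
    unfolding G'_def by (rule bounded_linear_Blinfun_apply[OF has_derivative_bounded_linear[OF der[OF that]]])
  show thesis
  proof (rule that[of G'])
    show "continuous_on S G'"
    proof (rule continuous_on_blinfun_componentwise)
      fix v
      have "continuous_on S (\<lambda>p. D p v)"
        unfolding D_def
        by (intro continuous_intros smooth_on_continuous[OF f]
            smooth_on_continuous_frechet_derivative[OF f] smooth_on_continuous_frechet_derivative[OF g])
      thus "continuous_on S (\<lambda>p. G' p v)" by (rule continuous_on_cong[THEN iffD1, rotated 2]) (simp_all add: G')
    qed
  qed (use der G' in \<open>auto simp: D_def\<close>)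
qed

text \<open>The last component of a solution of the extended system has derivative 0, so it keeps the value
  \<open>\<epsilon>\<close>, and rescaling time by \<open>\<epsilon>\<close> turns the other components into a solution of the fast-slow system,
  which the exact flow must reproduce.\<close>

lemma rescaled_flow:
  fixes u :: "real \<Rightarrow> (real^'s) \<times> (real^'f) \<times> real"
  assumes flow: "exact_flow (fast_slow_field f g \<epsilon>) \<phi>" and \<epsilon>: "\<epsilon> > 0"
    and u0: "u 0 = (x, y, \<epsilon>)"
    and u: "\<And>t. t \<in> {0..T} \<Longrightarrow> (u has_vector_derivative extended_field f g (u t)) (at t within {0..T})"
    and t: "t \<in> {0..T}"
  shows "\<phi> (x, y) (t * \<epsilon>) = (fst (u t), fst (snd (u t)))"
proof -
  have third: "snd (snd (u t)) = \<epsilon>" if "t \<in> {0..T}" for t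
  proof -
    have "snd (snd (u t)) - \<epsilon> = 0"
    proof (rule linear_ode_zero[OF bounded_linear_zero _ that])
      fix t assume "t \<in> {0..T}"
      from bounded_linear.has_vector_derivative[OF bounded_linear_snd
          bounded_linear.has_vector_derivative[OF bounded_linear_snd u[OF this]]]
      show "((\<lambda>t. snd (snd (u t)) - \<epsilon>) has_vector_derivative 0) (at t within {0..T})"
        by (auto simp: extended_field_def case_prod_unfold intro!: derivative_eq_intros)
    qed (simp add: u0)
    thus ?thesis by simp
  qed
  define U where "U s = (fst (u (s / \<epsilon>)), fst (snd (u (s / \<epsilon>))))" for s
  have "(U has_vector_derivative fast_slow_field f g \<epsilon> (U s)) (at s within {0..t * \<epsilon>})"
    if s: "s \<in> {0..t * \<epsilon>}" for s
  proof -
    have img: "(\<lambda>s. s / \<epsilon>) ` {0..t * \<epsilon>} \<subseteq> {0..T}" using \<epsilon> t by (auto simp: field_simps)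
    hence sT: "s / \<epsilon> \<in> {0..T}" using s by blast
    have "((\<lambda>s. s / \<epsilon>) has_vector_derivative 1 / \<epsilon>) (at s within {0..t * \<epsilon>})"
      using \<epsilon> by (auto intro!: derivative_eq_intros simp: has_real_derivative_iff_has_vector_derivative[symmetric])
    from vector_diff_chain_within[OF this has_vector_derivative_within_subset[OF u[OF sT] img]]
    have d: "((\<lambda>s. u (s / \<epsilon>)) has_vector_derivative (1 / \<epsilon>) *\<^sub>R extended_field f g (u (s / \<epsilon>))) (at s within {0..t * \<epsilon>})"
      by (simp add: o_def)
    have "bounded_linear (\<lambda>p :: (real^'s) \<times> (real^'f) \<times> real. (fst p, fst (snd p)))"
      by (intro bounded_linear_Pair bounded_linear_fst bounded_linear_fst_comp bounded_linear_snd)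
    from bounded_linear.has_vector_derivative[OF this d] show ?thesis
      unfolding U_def using \<epsilon> third[OF sT]
      by (simp add: extended_field_def fast_slow_field_def case_prod_unfold)
  qed
  moreover have "U 0 = (x, y)" by (simp add: U_def u0)
  moreover have "0 \<le> t * \<epsilon>" using t \<epsilon> by simp
  ultimately have "\<phi> (x, y) (t * \<epsilon>) = U (t * \<epsilon>)"
    using flow unfolding exact_flow_def by blast
  thus ?thesis using \<epsilon> by (simp add: U_def)
qed

text \<open>The coefficients of the flow at the times \<open>l H\<close> in the iteration function; the case distinction
  accounts for the term \<open>y\<close>, the flow at time 0.\<close>

definition jacobian_coeff :: "nat \<Rightarrow> nat \<Rightarrow> real" where
  "jacobian_coeff n l = (if l = 0 then 1 else 0) - (-1) ^ l * real (n choose l)"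

lemma Fhat_eq_combination:
  assumes "0 < \<sigma>" "0 < \<epsilon>" "\<phi> (x0, y) 0 = (x0, y)"
  shows "Fhat \<phi> x0 (\<sigma> * \<epsilon>) (\<sigma> * \<epsilon>) m y =
    (\<Sum>l=0..m+1. jacobian_coeff (m + 1) l *\<^sub>R snd (\<phi> (x0, y) (real l * \<sigma> * \<epsilon>)))"
proof -
  have "(-1::real) ^ (m + 1) * (-1) ^ (m + 1 - l) = (-1) ^ l" if "l \<le> m + 1" for l
  proof -
    have "(-1::real) ^ (m + 1) * (-1) ^ (m + 1 - l) = (-1) ^ (l + 2 * (m + 1 - l))"
      using that by (simp only: power_add[symmetric]) (rule arg_cong[of _ _ "(^) _"], linarith)
    thus ?thesis by (simp add: power_add power_mult)
  qed
  hence "(-1) ^ (m + 1) *\<^sub>R forward_difference_y \<phi> (\<sigma> * \<epsilon>) (m + 1) (x0, y) =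
      (\<Sum>l=0..m+1. ((-1) ^ l * real ((m + 1) choose l)) *\<^sub>R snd (\<phi> (x0, y) (real l * \<sigma> * \<epsilon>)))"
    unfolding forward_difference_y_def scaleR_sum_right
    by (intro sum.cong refl) (simp del: power_Suc binomial_Suc_Suc add: mult.assoc[symmetric])
  moreover have "(\<Sum>l=0..m+1. (if l = 0 then 1 else 0) *\<^sub>R snd (\<phi> (x0, y) (real l * \<sigma> * \<epsilon>))) = y"
    using assms(3) by (subst sum.mono_neutral_right[of _ "{0}"]) auto
  moreover have "- (\<sigma> * \<epsilon> / (\<sigma> * \<epsilon>)) = -1" using assms by simp
  ultimately show ?thesis
    unfolding Fhat_def jacobian_coeff_def scaleR_diff_left sum_subtractf by simp
qed

lemma bigo_tendsto_zero:
  fixes f g :: "real \<Rightarrow> real"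
  assumes "f \<in> O[F](g)" "(g \<longlongrightarrow> 0) F"
  shows "(f \<longlongrightarrow> 0) F"
proof -
  obtain c where "\<forall>\<^sub>F x in F. norm (f x) \<le> c * norm (g x)"
    using assms(1) by (auto elim: landau_o.bigE)
  moreover have "((\<lambda>x. c * norm (g x)) \<longlongrightarrow> 0) F"
    using assms(2) by (auto intro!: tendsto_eq_intros)
  ultimately show ?thesis by (rule Lim_null_comparison)
qed

text \<open>The fixed points converge to \<open>y0 = hc 0 x0\<close>, hence the points \<open>pe \<epsilon>\<close> at which the iteration
  function is differentiated converge to the equilibrium \<open>p0\<close> of the extended field, and the
  derivatives of the flow converge to the one at \<open>p0\<close>. At \<open>p0\<close> the linearized extended system leaves
  the fast directions invariant, since the slow velocity carries a factor \<open>\<epsilon>\<close>, and it acts on them by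
  the fast Jacobian \<open>B\<close>.\<close>

lemma leading_order_jacobian_exists:
  fixes f :: "real^'s \<Rightarrow> real^'f \<Rightarrow> real \<Rightarrow> real^'s" and g :: "real^'s \<Rightarrow> real^'f \<Rightarrow> real \<Rightarrow> real^'f"
  assumes system: "fast_slow_system \<epsilon>0 f g"
    and manifold: "attracting_slow_manifold \<epsilon>0 f g K h hc"
    and x0: "x0 \<in> K"
    and flow: "\<And>\<epsilon>. 0 < \<epsilon> \<Longrightarrow> \<epsilon> < \<epsilon>0 \<Longrightarrow> exact_flow (fast_slow_field f g \<epsilon>) (\<Phi> \<epsilon>)"
    and fixed_points: "fixed_point_branch \<Phi> x0 h yhat m \<sigma> \<sigma>" and \<sigma>: "0 < \<sigma>"
  obtains X where "X 0 = mat 1"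
    "\<And>t. t \<in> {0..real (m + 1) * \<sigma>} \<Longrightarrow>
      (X has_vector_derivative fast_jacobian g x0 (hc 0 x0) ** X t) (at t within {0..real (m + 1) * \<sigma>})"
    "leading_order_jacobian \<Phi> x0 yhat m \<sigma> \<sigma>
      (\<Sum>l=0..m+1. jacobian_coeff (m + 1) l *\<^sub>R X (real l * \<sigma>))"
proof -
  define y0 where "y0 = hc 0 x0"
  define p0 :: "(real^'s) \<times> (real^'f) \<times> real" where "p0 = (x0, y0, 0)"
  define S :: "((real^'s) \<times> (real^'f) \<times> real) set" where "S = UNIV \<times> UNIV \<times> {-\<epsilon>0<..<\<epsilon>0}"
  define T where "T = real (m + 1) * \<sigma>"
  define ff where "ff = (\<lambda>(x, y, \<epsilon>). f x y \<epsilon>)"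
  define gg where "gg = (\<lambda>(x, y, \<epsilon>). g x y \<epsilon>)"
  have smooth: "0 < \<epsilon>0" "smooth_on S ff" "smooth_on S gg"
    using system unfolding fast_slow_system_def S_def ff_def gg_def by auto
  have S: "open S" "p0 \<in> S" using smooth(1) by (auto simp: S_def p0_def intro!: open_Times)
  have T: "0 \<le> T" using \<sigma> by (simp add: T_def)
  have lT: "real l * \<sigma> \<in> {0..T}" if "l \<le> m + 1" for l
    using that \<sigma> unfolding T_def by (auto intro!: mult_right_mono simp del: of_nat_Suc)
  obtain G' where G': "\<And>p. p \<in> S \<Longrightarrow> (extended_field f g has_derivative blinfun_apply (G' p)) (at p)"
    "continuous_on S G'"
    "\<And>p v. p \<in> S \<Longrightarrow> G' p v = (snd (snd v) *\<^sub>R ff p + snd (snd p) *\<^sub>R frechet_derivative ff (at p) v,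
       frechet_derivative gg (at p) v, 0)"
    using extended_field_derivative[OF smooth(2,3)[unfolded ff_def gg_def]] unfolding ff_def gg_def by blast
  have "g x0 y0 0 = 0" using manifold x0 by (auto simp: attracting_slow_manifold_def y0_def)
  hence eq: "extended_field f g p0 = 0" by (simp add: extended_field_def p0_def zero_prod_def)
  obtain \<delta> u V where \<delta>: "\<delta> > 0" and u0: "\<And>p. u p 0 = p"
    and uS: "\<And>p t. p \<in> ball p0 \<delta> \<Longrightarrow> t \<in> {0..T} \<Longrightarrow> u p t \<in> S"
    and u: "\<And>p t. p \<in> ball p0 \<delta> \<Longrightarrow> t \<in> {0..T} \<Longrightarrow>
      (u p has_vector_derivative extended_field f g (u p t)) (at t within {0..T})"
    and V: "\<And>p t. p \<in> ball p0 \<delta> \<Longrightarrow> t \<in> {0..T} \<Longrightarrow>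
      ((\<lambda>q. u q t) has_derivative blinfun_apply (V p t)) (at p)"
    and Vlim: "\<And>t. t \<in> {0..T} \<Longrightarrow> ((\<lambda>p. V p t) \<longlongrightarrow> V p0 t) (at p0)"
    and V0: "V p0 0 = id_blinfun"
    and V': "\<And>t. t \<in> {0..T} \<Longrightarrow>
      (V p0 has_vector_derivative G' p0 o\<^sub>L V p0 t) (at t within {0..T})"
    using flow_near_equilibrium[OF S eq T G'(1,2)] by blast
  define B where "B = fast_jacobian g x0 y0"
  have B: "B *v b = frechet_derivative gg (at p0) (0, b, 0)" for b
  proof -
    have "((\<lambda>y. (x0, y, 0::real)) has_derivative (\<lambda>b. (0, b, 0))) (at y0)"
      by (intro has_derivative_Pair has_derivative_const has_derivative_ident)
    from has_derivative_compose[OF this, of gg] smooth_on_frechet_derivative[OF smooth(3) S(2)]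
    have "((\<lambda>y. g x0 y 0) has_derivative (\<lambda>b. frechet_derivative gg (at p0) (0, b, 0))) (at y0)"
      by (simp add: gg_def p0_def)
    moreover from this have "((\<lambda>y. g x0 y 0) has_derivative (\<lambda>b. B *v b)) (at y0)"
      unfolding B_def fast_jacobian_def using jacobian_works differentiable_def by blast
    ultimately show ?thesis using has_derivative_unique by metis
  qed
  define X where "X t = fast_block (V p0 t)" for t
  have X0: "X 0 = mat 1"
    unfolding X_def V0 fast_block_def by (simp add: matrix_id_mat_1[unfolded id_def])
  have X': "(X has_vector_derivative B ** X t) (at t within {0..T})" if t: "t \<in> {0..T}" for t
  proof -
    have w: "V p0 t (0, b, 0) = (0, X t *v b, 0)" if t: "t \<in> {0..T}" for b t
    proof -
      define w where "w = (\<lambda>t. V p0 t (0, b, 0))"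
      have dw: "(w has_vector_derivative G' p0 (w t)) (at t within {0..T})" if "t \<in> {0..T}" for t
        using bounded_linear.has_vector_derivative[OF blinfun.bounded_linear_left V'[OF that]]
        by (simp add: w_def)
      have w0: "w 0 = (0, b, 0)" by (simp add: w_def V0)
      have third: "snd (snd (w t)) = 0" if "t \<in> {0..T}" for t
      proof (rule linear_ode_zero[OF bounded_linear_zero _ that])
        fix t assume "t \<in> {0..T}"
        from bounded_linear.has_vector_derivative[OF bounded_linear_snd
            bounded_linear.has_vector_derivative[OF bounded_linear_snd dw[OF this]]]
        show "((\<lambda>t. snd (snd (w t))) has_vector_derivative 0) (at t within {0..T})"
          by (simp add: G'(3) S)
      qed (simp add: w0)
      have first: "fst (w t) = 0"
      proof (rule linear_ode_zero[OF bounded_linear_zero _ t])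
        fix t assume t: "t \<in> {0..T}"
        from bounded_linear.has_vector_derivative[OF bounded_linear_fst dw[OF t]]
        show "((\<lambda>t. fst (w t)) has_vector_derivative 0) (at t within {0..T})"
          by (simp add: G'(3) S third[OF t]) (simp add: p0_def)
      qed (simp add: w0)
      show ?thesis
        using first third[OF t] by (simp add: w_def prod_eq_iff X_def fast_block_mult)
    qed
    have "fast_block (G' p0 o\<^sub>L V p0 t) *v b = (B ** X t) *v b" for b
      by (simp add: fast_block_mult w[OF t] G'(3) S B matrix_vector_mul_assoc[symmetric])
    hence "fast_block (G' p0 o\<^sub>L V p0 t) = B ** X t" by (simp add: matrix_eq)
    thus ?thesis
      using bounded_linear.has_vector_derivative[OF bounded_linear_fast_block V'[OF t]]
      unfolding X_def by simp
  qed
  define ye where "ye \<epsilon> = yhat m \<epsilon> (\<sigma> * \<epsilon>) (\<sigma> * \<epsilon>)" for \<epsilon>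
  define pe where "pe \<epsilon> = (x0, ye \<epsilon>, \<epsilon>)" for \<epsilon>
  have ye: "(ye \<longlongrightarrow> y0) (at_right 0)"
  proof -
    have pow0: "((\<lambda>\<epsilon>::real. \<epsilon> ^ (n + 1)) \<longlongrightarrow> 0) (at_right 0)" for n
      by (auto intro!: tendsto_eq_intros)
    have "(\<lambda>\<epsilon>. norm (ye \<epsilon> - h \<epsilon> x0)) \<in> O[at_right 0](\<lambda>\<epsilon>. \<epsilon> ^ (m + 1))"
      using fixed_points by (simp add: fixed_point_branch_def ye_def)
    hence 1: "((\<lambda>\<epsilon>. norm (ye \<epsilon> - h \<epsilon> x0)) \<longlongrightarrow> 0) (at_right 0)"
      using pow0 by (rule bigo_tendsto_zero)
    have "(\<lambda>\<epsilon>. norm (h \<epsilon> x0 - (\<Sum>i\<le>0. \<epsilon> ^ i *\<^sub>R hc i x0))) \<in> O[at_right 0](\<lambda>\<epsilon>. \<epsilon> ^ (0 + 1))"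
      using manifold x0 unfolding attracting_slow_manifold_def by blast
    hence "(\<lambda>\<epsilon>. norm (h \<epsilon> x0 - y0)) \<in> O[at_right 0](\<lambda>\<epsilon>. \<epsilon> ^ (0 + 1))" by (simp add: y0_def)
    hence 2: "((\<lambda>\<epsilon>. norm (h \<epsilon> x0 - y0)) \<longlongrightarrow> 0) (at_right 0)"
      using pow0 by (rule bigo_tendsto_zero)
    have "((\<lambda>\<epsilon>. (ye \<epsilon> - h \<epsilon> x0) + (h \<epsilon> x0 - y0)) \<longlongrightarrow> 0 + 0) (at_right 0)"
      using 1 2 by (intro tendsto_add) (simp_all add: tendsto_norm_zero_iff)
    thus ?thesis by (simp add: LIM_zero_iff)
  qed
  have pe: "(pe \<longlongrightarrow> p0) (at_right 0)"
    unfolding pe_def p0_def by (intro tendsto_intros ye)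
  have pe_at: "filterlim pe (at p0) (at_right 0)"
    unfolding filterlim_at using pe
    by (auto simp: pe_def p0_def eventually_at_right_field intro!: exI[of _ 1])
  define J where "J p = (\<Sum>l=0..m+1. jacobian_coeff (m + 1) l *\<^sub>R fast_block (V p (real l * \<sigma>)))" for p
  have deriv: "(Fhat (\<Phi> \<epsilon>) x0 (\<sigma> * \<epsilon>) (\<sigma> * \<epsilon>) m has_derivative (\<lambda>b. J (pe \<epsilon>) *v b)) (at (ye \<epsilon>))"
    if \<epsilon>: "0 < \<epsilon>" and pin: "pe \<epsilon> \<in> ball p0 \<delta>" for \<epsilon>
  proof -
    define Y where "Y = (\<lambda>y. (x0, y, \<epsilon>)) -` ball p0 \<delta>"
    have "open Y" unfolding Y_def by (intro open_vimage continuous_intros) auto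
    have yY: "ye \<epsilon> \<in> Y" using pin by (simp add: Y_def pe_def)
    have "u (pe \<epsilon>) 0 \<in> S" using pin T by (intro uS) auto
    hence "\<epsilon> < \<epsilon>0" by (simp add: u0 S_def pe_def)
    note fl = flow[OF \<epsilon> this]
    have fast: "((\<lambda>y. fst (snd (u (x0, y, \<epsilon>) t))) has_derivative (\<lambda>b. fast_block (V (pe \<epsilon>) t) *v b)) (at (ye \<epsilon>))"
      if t: "t \<in> {0..T}" for t
    proof -
      have "((\<lambda>y. (x0, y, \<epsilon>)) has_derivative (\<lambda>b. (0, b, 0))) (at (ye \<epsilon>))"
        by (intro has_derivative_Pair has_derivative_const has_derivative_ident)
      from has_derivative_compose[OF this V[OF pin t, unfolded pe_def]]
      have "((\<lambda>y. fst (snd (u (x0, y, \<epsilon>) t))) has_derivative (\<lambda>b. fst (snd (V (pe \<epsilon>) t (0, b, 0))))) (at (ye \<epsilon>))"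
        unfolding pe_def by (intro has_derivative_fst has_derivative_snd)
      thus ?thesis by (simp add: fast_block_mult)
    qed
    have "((\<lambda>y. \<Sum>l=0..m+1. jacobian_coeff (m + 1) l *\<^sub>R fst (snd (u (x0, y, \<epsilon>) (real l * \<sigma>)))) has_derivative
        (\<lambda>b. \<Sum>l=0..m+1. jacobian_coeff (m + 1) l *\<^sub>R (fast_block (V (pe \<epsilon>) (real l * \<sigma>)) *v b))) (at (ye \<epsilon>))"
      by (intro has_derivative_sum has_derivative_scaleR_right fast lT) auto
    also have "(\<lambda>b. \<Sum>l=0..m+1. jacobian_coeff (m + 1) l *\<^sub>R (fast_block (V (pe \<epsilon>) (real l * \<sigma>)) *v b)) =
        (\<lambda>b. J (pe \<epsilon>) *v b)"
    proof
      fix b :: "real^'f"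
      have lin: "linear (\<lambda>M :: real^'f^'f. M *v b)"
        by (rule linearI) (simp_all add: matrix_vector_mult_add_rdistrib scaleR_matrix_vector_assoc)
      show "(\<Sum>l=0..m+1. jacobian_coeff (m + 1) l *\<^sub>R (fast_block (V (pe \<epsilon>) (real l * \<sigma>)) *v b)) = J (pe \<epsilon>) *v b"
        unfolding J_def linear_sum[OF lin] linear_cmul[OF lin] ..
    qed
    finally show ?thesis
    proof (rule has_derivative_transform_within_open[OF _ \<open>open Y\<close> yY])
      fix y assume "y \<in> Y"
      hence py: "(x0, y, \<epsilon>) \<in> ball p0 \<delta>" by (simp add: Y_def)
      have fl_eq: "\<Phi> \<epsilon> (x0, y) (t * \<epsilon>) = (fst (u (x0, y, \<epsilon>) t), fst (snd (u (x0, y, \<epsilon>) t)))"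
        if "t \<in> {0..T}" for t
        by (rule rescaled_flow[OF fl \<epsilon> u0 u[OF py] that])
      have "\<Phi> \<epsilon> (x0, y) 0 = (x0, y)" using fl_eq[of 0] T by (simp add: u0)
      from Fhat_eq_combination[of \<sigma> \<epsilon> "\<Phi> \<epsilon>" x0 y m, OF \<sigma> \<epsilon> this]
      show "(\<Sum>l=0..m+1. jacobian_coeff (m + 1) l *\<^sub>R fst (snd (u (x0, y, \<epsilon>) (real l * \<sigma>)))) =
          Fhat (\<Phi> \<epsilon>) x0 (\<sigma> * \<epsilon>) (\<sigma> * \<epsilon>) m y"
        using fl_eq[OF lT] by simp
    qed
  qed
  have ev: "\<forall>\<^sub>F \<epsilon> in at_right 0. 0 < \<epsilon> \<and> pe \<epsilon> \<in> ball p0 \<delta>"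
    using eventually_at_right_less tendstoD[OF pe \<delta>] by eventually_elim (auto simp: dist_commute)
  have Jlim: "((\<lambda>\<epsilon>. J (pe \<epsilon>)) \<longlongrightarrow> (\<Sum>l=0..m+1. jacobian_coeff (m + 1) l *\<^sub>R X (real l * \<sigma>))) (at_right 0)"
    unfolding J_def X_def
    by (intro tendsto_sum tendsto_scaleR tendsto_const bounded_linear.tendsto[OF bounded_linear_fast_block]
        filterlim_compose[OF Vlim pe_at] lT) auto
  have "leading_order_jacobian \<Phi> x0 yhat m \<sigma> \<sigma>
      (\<Sum>l=0..m+1. jacobian_coeff (m + 1) l *\<^sub>R X (real l * \<sigma>))"
    unfolding leading_order_jacobian_def ye_def[symmetric]
  proof
    show "\<forall>\<^sub>F \<epsilon> in at_right 0. Fhat (\<Phi> \<epsilon>) x0 (\<sigma> * \<epsilon>) (\<sigma> * \<epsilon>) m differentiable (at (ye \<epsilon>))"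
      using ev by eventually_elim (use deriv differentiableI in blast)
    have "\<forall>\<^sub>F \<epsilon> in at_right 0. J (pe \<epsilon>) = jacobian (Fhat (\<Phi> \<epsilon>) x0 (\<sigma> * \<epsilon>) (\<sigma> * \<epsilon>) m) (at (ye \<epsilon>))"
      using ev
    proof eventually_elim
      case (elim \<epsilon>)
      hence "frechet_derivative (Fhat (\<Phi> \<epsilon>) x0 (\<sigma> * \<epsilon>) (\<sigma> * \<epsilon>) m) (at (ye \<epsilon>)) = (\<lambda>b. J (pe \<epsilon>) *v b)"
        using frechet_derivative_at[OF deriv] by simp
      thus ?case by (simp add: jacobian_def)
    qed
    thus "((\<lambda>\<epsilon>. jacobian (Fhat (\<Phi> \<epsilon>) x0 (\<sigma> * \<epsilon>) (\<sigma> * \<epsilon>) m) (at (ye \<epsilon>))) \<longlongrightarrow>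
        (\<Sum>l=0..m+1. jacobian_coeff (m + 1) l *\<^sub>R X (real l * \<sigma>))) (at_right 0)"
      using Jlim by (rule Lim_transform_eventually[rotated])
  qed
  thus thesis using that[of X] X0 X' unfolding T_def B_def y0_def by blast
qed

section \<open>Stability of the iteration\<close>

lemma amplification_eq_sum:
  "amplification n (of_real \<sigma> * z) =
    (\<Sum>l=0..n. of_real (jacobian_coeff n l) * exp (of_real (real l * \<sigma>) * z))"
proof -
  define w where "w = exp (of_real \<sigma> * z)"
  have w: "exp (of_real (real l * \<sigma>) * z) = w ^ l" for l
    unfolding w_def by (simp add: exp_of_nat_mult[symmetric] mult.assoc)
  have "(\<Sum>l=0..n. of_real (jacobian_coeff n l) * w ^ l) =
      (\<Sum>l=0..n. (if l = 0 then 1 else 0) * w ^ l) - (\<Sum>l\<le>n. of_nat (n choose l) * (- w) ^ l)"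
    unfolding sum_subtractf[symmetric] atMost_atLeast0
    by (intro sum.cong refl) (simp add: jacobian_coeff_def power_minus[of w] algebra_simps)
  also have "(\<Sum>l=0..n. (if l = 0 then 1 else 0) * w ^ l) = 1"
    by (subst sum.mono_neutral_right[of _ "{0}"]) auto
  also have "(\<Sum>l\<le>n. of_nat (n choose l) * (- w) ^ l) = (1 - w) ^ n"
    using binomial_ring[of "- w" 1 n] by simp
  finally show ?thesis by (simp only: w amplification_def w_def)
qed

text \<open>The definition of stability asks for some leading-order Jacobian; as a limit it is unique, so the
  one built from the matrix exponential decides.\<close>

lemma scheme_stable_iff_amplification:
  fixes f :: "real^'s \<Rightarrow> real^'f \<Rightarrow> real \<Rightarrow> real^'s" and g :: "real^'s \<Rightarrow> real^'f \<Rightarrow> real \<Rightarrow> real^'f"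
  assumes system: "fast_slow_system \<epsilon>0 f g"
    and manifold: "attracting_slow_manifold \<epsilon>0 f g K h hc"
    and x0: "x0 \<in> K"
    and flow: "\<And>\<epsilon>. 0 < \<epsilon> \<Longrightarrow> \<epsilon> < \<epsilon>0 \<Longrightarrow> exact_flow (fast_slow_field f g \<epsilon>) (\<Phi> \<epsilon>)"
    and fixed_points: "\<And>m \<sigma>. 0 < \<sigma> \<Longrightarrow> fixed_point_branch \<Phi> x0 h yhat m \<sigma> \<sigma>"
    and eigenvalues: "eigenvalue_list (fast_jacobian g x0 (hc 0 x0)) lam"
    and pos: "0 < \<epsilon>" "0 < H"
  shows "scheme_stable \<Phi> x0 yhat m \<epsilon> H H \<longleftrightarrow>
    (\<forall>l. cmod (amplification (m + 1) (of_real (H / \<epsilon>) * lam l)) < 1)"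
proof -
  define \<sigma> where "\<sigma> = H / \<epsilon>"
  have \<sigma>: "0 < \<sigma>" using pos by (simp add: \<sigma>_def)
  obtain X where X: "X 0 = mat 1"
    "\<And>t. t \<in> {0..real (m + 1) * \<sigma>} \<Longrightarrow>
      (X has_vector_derivative fast_jacobian g x0 (hc 0 x0) ** X t) (at t within {0..real (m + 1) * \<sigma>})"
    "leading_order_jacobian \<Phi> x0 yhat m \<sigma> \<sigma>
      (\<Sum>l=0..m+1. jacobian_coeff (m + 1) l *\<^sub>R X (real l * \<sigma>))"
    using leading_order_jacobian_exists[OF system manifold x0 flow fixed_points[OF \<sigma>, of m] \<sigma>] by blast
  define A where "A = (\<Sum>l=0..m+1. jacobian_coeff (m + 1) l *\<^sub>R X (real l * \<sigma>))"
  have unique: "A' = A" if "leading_order_jacobian \<Phi> x0 yhat m \<sigma> \<sigma> A'" for A'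
    using that X(3) unfolding leading_order_jacobian_def A_def
    by (blast intro: tendsto_unique[OF trivial_limit_at_right_real])
  have "spectrum A = (\<lambda>z. amplification (m + 1) (of_real \<sigma> * z)) ` spectrum (fast_jacobian g x0 (hc 0 x0))"
    unfolding A_def amplification_eq_sum
    by (rule spectrum_matrix_flow_combination[OF X(1,2)])
      (use \<sigma> in \<open>auto intro!: mult_right_mono simp del: of_nat_Suc\<close>)
  also have "spectrum (fast_jacobian g x0 (hc 0 x0)) = range lam"
    by (rule spectrum_eq_range_eigenvalue_list[OF eigenvalues])
  finally have "spectrum A \<subseteq> ball 0 1 \<longleftrightarrow> (\<forall>l. cmod (amplification (m + 1) (of_real \<sigma> * lam l)) < 1)"
    by (simp add: image_subset_iff)
  moreover have "scheme_stable \<Phi> x0 yhat m \<epsilon> H H \<longleftrightarrow> spectrum A \<subseteq> ball 0 1"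
    unfolding scheme_stable_def \<sigma>_def[symmetric] using unique X(3) A_def by metis
  ultimately show ?thesis unfolding \<sigma>_def by simp
qed

theorem theorem6p1:
  fixes f :: "real^'s \<Rightarrow> real^'f \<Rightarrow> real \<Rightarrow> real^'s"
    and g :: "real^'s \<Rightarrow> real^'f \<Rightarrow> real \<Rightarrow> real^'f"
    and h :: "real \<Rightarrow> real^'s \<Rightarrow> real^'f"
    and hc :: "nat \<Rightarrow> real^'s \<Rightarrow> real^'f"
    and K :: "(real^'s) set"
    and x0 :: "real^'s"
    and \<Phi> :: "real \<Rightarrow> (real^'s) \<times> (real^'f) \<Rightarrow> real \<Rightarrow> (real^'s) \<times> (real^'f)"
    and yhat :: "nat \<Rightarrow> real \<Rightarrow> real \<Rightarrow> real \<Rightarrow> real^'f"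
    and lam :: "'f \<Rightarrow> complex"
    and \<theta> :: "'f \<Rightarrow> real"
    and \<epsilon>0 :: real
  assumes system: "fast_slow_system \<epsilon>0 f g"
    and manifold: "attracting_slow_manifold \<epsilon>0 f g K h hc"
    and x0: "x0 \<in> K"
    and flow: "\<And>\<epsilon>. 0 < \<epsilon> \<Longrightarrow> \<epsilon> < \<epsilon>0 \<Longrightarrow> exact_flow (fast_slow_field f g \<epsilon>) (\<Phi> \<epsilon>)"
    and fixed_points: "\<And>m \<sigma>. 0 < \<sigma> \<Longrightarrow> fixed_point_branch \<Phi> x0 h yhat m \<sigma> \<sigma>"
    and eigenvalues: "eigenvalue_list (fast_jacobian g x0 (hc 0 x0)) lam"
    and angles: "\<And>l. \<theta> l \<in> {pi/2<..<3*pi/2} \<and> lam l = complex_of_real (cmod (lam l)) * exp (\<i> * complex_of_real (\<theta> l))"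
  shows "unconditionally_stable \<Phi> x0 yhat 0 1 \<and>
    (\<forall>m\<ge>1.
       (\<forall>\<epsilon>>0. \<forall>H>0. scheme_stable \<Phi> x0 yhat m \<epsilon> H H \<longleftrightarrow>
          (\<forall>l. (H, \<theta> l) \<in> stability_region m \<epsilon> (Re (lam l)))) \<and>
       (\<forall>\<epsilon>>0. \<forall>l. frontier (stability_region m \<epsilon> (Re (lam l))) \<inter> parameter_domain =
          {(H, t) \<in> parameter_domain. 1 = stability_rhs m (- Re (lam l) * H / \<epsilon>) t}) \<and>
       ((\<forall>l. lam l \<in> \<real>) \<longrightarrow> unconditionally_stable \<Phi> x0 yhat m 1) \<and>
       ((\<exists>l. Im (lam l) \<noteq> 0) \<longrightarrow>
          (\<forall>\<epsilon>>0. \<forall>H. H > \<epsilon> * H_s m / Min (range (\<lambda>l. \<bar>Re (lam l)\<bar>)) \<longrightarrow>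
             scheme_stable \<Phi> x0 yhat m \<epsilon> H H)) \<and>
       0 \<le> H_s m)"
proof -
  have neg: "Re (lam l) < 0" for l
  proof -
    have "lam l \<in> spectrum (fast_jacobian g x0 (hc 0 x0))"
      unfolding spectrum_eq_range_eigenvalue_list[OF eigenvalues] by simp
    thus ?thesis using manifold x0 unfolding attracting_slow_manifold_def by blast
  qed
  have stable: "scheme_stable \<Phi> x0 yhat m \<epsilon> H H \<longleftrightarrow>
      (\<forall>l. cmod (amplification (m + 1) (of_real (H / \<epsilon>) * lam l)) < 1)"
    if "0 < \<epsilon>" "0 < H" for m \<epsilon> H
    by (rule scheme_stable_iff_amplification[OF system manifold x0 flow fixed_points eigenvalues that])
  have real: "unconditionally_stable \<Phi> x0 yhat m 1" if "\<forall>l. lam l \<in> \<real>" for m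
    unfolding unconditionally_stable_def
  proof (intro allI impI)
    fix \<epsilon> H :: real assume pos: "0 < \<epsilon> \<and> 0 < H"
    have "cmod (amplification (m + 1) (of_real (H / \<epsilon>) * lam l)) < 1" for l
    proof -
      have "lam l = of_real (Re (lam l))" using that by (simp add: complex_is_Real_iff complex_eq_iff)
      hence "of_real (H / \<epsilon>) * lam l = complex_of_real (H / \<epsilon> * Re (lam l))"
        by (metis of_real_mult)
      thus ?thesis
        using amplification_real_less_1[of "H / \<epsilon> * Re (lam l)" "m + 1"] neg[of l] pos
        by (simp only: mult_pos_neg divide_pos_pos zero_less_Suc Suc_eq_plus1[symmetric])
    qed
    thus "scheme_stable \<Phi> x0 yhat m \<epsilon> H (H / 1)" using stable pos by simp
  qed
  have zero: "unconditionally_stable \<Phi> x0 yhat 0 1"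
    unfolding unconditionally_stable_def
  proof (intro allI impI)
    fix \<epsilon> H :: real assume pos: "0 < \<epsilon> \<and> 0 < H"
    hence "H / \<epsilon> * Re (lam l) < 0" for l using neg[of l] by (intro mult_pos_neg) auto
    hence "cmod (amplification (0 + 1) (of_real (H / \<epsilon>) * lam l)) < 1" for l
      by (simp add: amplification_def)
    thus "scheme_stable \<Phi> x0 yhat 0 \<epsilon> H (H / 1)" using stable[of \<epsilon> H 0] pos by simp
  qed
  have iff: "scheme_stable \<Phi> x0 yhat m \<epsilon> H H \<longleftrightarrow> (\<forall>l. (H, \<theta> l) \<in> stability_region m \<epsilon> (Re (lam l)))"
    if pos: "0 < \<epsilon>" "0 < H" for m \<epsilon> H
  proof -
    have "cmod (amplification (m + 1) (of_real (H / \<epsilon>) * lam l)) < 1 \<longleftrightarrow>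
        (H, \<theta> l) \<in> stability_region m \<epsilon> (Re (lam l))" for l
      using amplification_less_1_iff[of "lam l" "\<theta> l" m "H / \<epsilon>"] angles[of l] neg[of l] pos
      by (simp add: stability_region_def parameter_domain_def)
    thus ?thesis using stable[OF pos] by simp
  qed
  have large: "scheme_stable \<Phi> x0 yhat m \<epsilon> H H"
    if \<epsilon>: "0 < \<epsilon>" and H: "H > \<epsilon> * H_s m / Min (range (\<lambda>l. \<bar>Re (lam l)\<bar>))" for m \<epsilon> H
  proof -
    define \<mu> where "\<mu> = Min (range (\<lambda>l. \<bar>Re (lam l)\<bar>))"
    have "\<mu> \<in> range (\<lambda>l. \<bar>Re (lam l)\<bar>)" unfolding \<mu>_def by (intro Min_in) auto
    hence \<mu>: "\<mu> > 0" using neg by (auto simp: less_imp_neq)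
    have \<mu>_le: "\<mu> \<le> - Re (lam l)" for l
    proof -
      have "\<mu> \<le> \<bar>Re (lam l)\<bar>" unfolding \<mu>_def by (rule Min_le) auto
      thus ?thesis using neg[of l] by simp
    qed
    have "0 \<le> \<epsilon> * H_s m / \<mu>" using \<epsilon> \<mu> H_s_nonneg[of m] by simp
    hence "H > 0" using H by (simp add: \<mu>_def)
    have "cmod (amplification (m + 1) (of_real (H / \<epsilon>) * lam l)) < 1" for l
    proof (rule amplification_less_1_of_H_s)
      have "H_s m < H / \<epsilon> * \<mu>" using H \<epsilon> \<mu> by (simp add: \<mu>_def[symmetric] field_simps)
      also have "\<dots> \<le> H / \<epsilon> * - Re (lam l)" using \<mu>_le[of l] \<epsilon> \<open>H > 0\<close> by (intro mult_left_mono) auto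
      finally show "Re (of_real (H / \<epsilon>) * lam l) < - H_s m" by simp
    qed
    thus ?thesis using stable[OF \<epsilon> \<open>H > 0\<close>] by simp
  qed
  show ?thesis
    using zero iff frontier_stability_region[OF _ neg] real large H_s_nonneg by blast
qed

end
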